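(* Let $K\subset\mathbb{R}^n$ be a convex body and let $\phi:K\to\mathbb{R}^+=(0,\infty)$ be an integrable log-concave function. Then for all $0<\delta<|K|$, $$F_{\frac{e-1}{e}\delta}(K,\phi)\subseteq M_\delta(K,\phi)\subseteq F_{\frac{\delta}{e}}(K,\phi).$$ In particular, for $\phi\equiv 1$, $$K_{\frac{e-1}{e}\delta}\subseteq M_\delta(K)\subseteq K_{\frac{\delta}{e}}.$$
   Context: A convex body in $\mathbb{R}^n$ is a compact convex set with non-empty interior; $|K|$ is its Lebesgue volume. For a Borel measure $\mu$ on $\mathbb{R}^n$, the metronoid of $\mu$ is $$M(\mu)=\left\{\int_{\mathbb{R}^n} y f(y)\,d\mu(y)\;:\; f:\mathbb{R}^n\to[0,1]\text{ measurable},\ \int_{\mathbb{R}^n} f\,d\mu=1,\ \int_{\mathbb{R}^n} yf(y)\,d\mu(y)\text{ exists}\right\}$$ (empty if no such $f$ exists). The weighted Ulam floating body is $M_\delta(K,\phi)=M(\mu)$, where $\mu$ has density $\frac{\phi(x)}{\delta}\mathbf{1}_K(x)$ with respect to Lebesgue measure; $M_\delta(K)=M_\delta(K,1)$. For $\delta>0$ and $\phi:K\to\mathbb{R}$ integrable and positive almost everywhere, the weighted floating body is $$F_\delta(K,\phi)=\bigcap\left\{H^-:\ \int_{H^+\cap K}\phi(x)\,dx\le\delta\right\},$$ where the intersection is over all hyperplanes $H$ in $\mathbb{R}^n$, with $H^+$, $H^-$ the two closed half-spaces bounded by $H$ (in either labelling). For $\phi\equiv1$ one writes $K_\delta=F_\delta(K,1)$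 (the convex floating body). *)

theory Defs
  imports "HOL-Analysis.Analysis"
begin

definition convex_body :: "'a::euclidean_space set \<Rightarrow> bool" where
  "convex_body K \<longleftrightarrow> compact K \<and> convex K \<and> interior K \<noteq> {}"

text \<open>
  Measurability of \<open>f\<close> refers to the sigma-algebra of \<open>\<mu>\<close>: Borel functions if \<open>\<mu>\<close> lives on the
  Borel sets, Lebesgue measurable functions if it lives on the Lebesgue sets, as in
  \<open>weighted_ulam_floating_body\<close> below. The mass of \<open>f\<close> is an extended nonnegative integral, so that
  \<open>f\<close> of mass 1 is integrable; existence of the vector-valued integral is Bochner integrability.
\<close>

definition metronoid :: "'a::euclidean_space measure \<Rightarrow> 'a set" where
  "metronoid \<mu> = {(\<integral>y. f y *\<^sub>R y \<partial>\<mu>) | f :: 'a \<Rightarrow> real.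
      f \<in> borel_measurable \<mu> \<and> (\<forall>y. 0 \<le> f y \<and> f y \<le> 1) \<and>
      (\<integral>\<^sup>+y. ennreal (f y) \<partial>\<mu>) = 1 \<and> integrable \<mu> (\<lambda>y. f y *\<^sub>R y)}"

text \<open>
  A weight on \<open>K\<close> is a total function whose values outside \<open>K\<close> are irrelevant. The reference measure
  is the complete Lebesgue measure, since a log-concave weight on \<open>K\<close> can fail to be Borel measurable
  on the boundary of \<open>K\<close>.
\<close>

definition weighted_ulam_floating_body ::
    "real \<Rightarrow> 'a::euclidean_space set \<Rightarrow> ('a \<Rightarrow> real) \<Rightarrow> 'a set" where
  "weighted_ulam_floating_body \<delta> K \<phi> =
     metronoid (density lebesgue (\<lambda>x. ennreal (\<phi> x / \<delta> * indicator K x)))"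

definition ulam_floating_body :: "real \<Rightarrow> 'a::euclidean_space set \<Rightarrow> 'a set" where
  "ulam_floating_body \<delta> K = weighted_ulam_floating_body \<delta> K (\<lambda>_. 1)"

text \<open>
  The hyperplane is \<open>{x. u \<bullet> x = c}\<close> with \<open>u \<noteq> 0\<close>; replacing \<open>(u, c)\<close> by \<open>(-u, -c)\<close> exchanges the
  two closed half-spaces, so both labellings are covered.
\<close>

definition weighted_floating_body ::
    "real \<Rightarrow> 'a::euclidean_space set \<Rightarrow> ('a \<Rightarrow> real) \<Rightarrow> 'a set" where
  "weighted_floating_body \<delta> K \<phi> =
     \<Inter> {{x. u \<bullet> x \<le> c} | u c.
          u \<noteq> 0 \<and> set_lebesgue_integral lebesgue ({x. u \<bullet> x \<ge> c} \<inter> K) \<phi> \<le> \<delta>}"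

definition floating_body :: "real \<Rightarrow> 'a::euclidean_space set \<Rightarrow> 'a set" where
  "floating_body \<delta> K = weighted_floating_body \<delta> K (\<lambda>_. 1)"

end

theory Submission
  imports Defs "HOL-Probability.Distribution_Functions"
begin

text \<open>
  By the Prekopa--Leindler inequality the distribution function \<open>F\<close> of a linear functional \<open>u\<close> under a
  log-concave weight is log-concave. If \<open>m\<close> is the mean, a supporting exponential of \<open>F\<close> at \<open>m\<close>,
  integrated up to the right end of the (bounded) support, gives Gruenbaum's inequality \<open>F m > 1/e\<close>
  with strict inequality. Maximising \<open>u\<close> over the Ulam floating body is solved by the barycentre of
  the cap of mass \<open>\<delta>\<close> in direction \<open>u\<close>, which is again a log-concave weight, so the half-space
  supporting the Ulam floating body cuts off mass strictly between \<open>\<delta>/e\<close> and \<open>(1 - 1/e)\<delta>\<close>. The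
  strictness makes plain separation of a point from a convex set sufficient: the Ulam floating body
  need not be known to be closed. If \<open>\<delta>\<close> exceeds the total mass, the left-hand body is empty,
  since \<open>1 - 1/e > 1/2\<close> and some half-space through any point has at most half of the mass.
\<close>

section \<open>The Prekopa--Leindler inequality\<close>

text \<open>Take \<open>a\<close> near the top of \<open>A\<close> and \<open>b\<close> near the
  bottom of \<open>B\<close>. The midpoints of \<open>b\<close> with points of \<open>A\<close> up
  to \<open>a\<close>, and those of \<open>a\<close> with points of \<open>B\<close> beyond
  \<open>b\<close>, lie in \<open>C\<close> on different sides of \<open>(a + b) / 2\<close>, so
  their measures add up. Supremum and infimum need not be attained, which costs \<open>e / 2\<close>
  for each set. A set \<open>C\<close> containing all midpoints replaces the sumset, whose
  measurability is thereby no issue.\<close>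

lemma midpoint_Brunn_Minkowski_real:
  fixes A B C :: "real set"
  assumes [measurable]: "A \<in> sets borel" "B \<in> sets borel" "C \<in> sets borel"
    and "bounded A" "bounded B" "A \<noteq> {}" "B \<noteq> {}"
    and mid: "\<And>a b. a \<in> A \<Longrightarrow> b \<in> B \<Longrightarrow> (a + b) / 2 \<in> C"
  shows "emeasure lborel A + emeasure lborel B \<le> 2 * emeasure lborel C"
proof (rule ennreal_le_epsilon)
  fix e :: real
  assume "0 < e"
  have bdd: "bdd_above A" "bdd_below B"
    using assms by (auto intro: bounded_imp_bdd_above bounded_imp_bdd_below)
  obtain a where a: "a \<in> A" "Sup A - e / 2 < a"
    using less_cSupD[OF \<open>A \<noteq> {}\<close>, of "Sup A - e / 2"] \<open>0 < e\<close> by auto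
  obtain b where b: "b \<in> B" "b < Inf B + e / 2"
    using cInf_lessD[OF \<open>B \<noteq> {}\<close>, of "Inf B + e / 2"] \<open>0 < e\<close> by auto
  let ?A = "A \<inter> {..a}" and ?B = "B \<inter> {b<..}"
  have "emeasure lborel A \<le> emeasure lborel (?A \<union> {a..a + e / 2})"
    using a cSup_upper[OF _ bdd(1)] by (intro emeasure_mono) fastforce+
  also have "\<dots> \<le> emeasure lborel ?A + e / 2"
    using \<open>0 < e\<close> by (intro order_trans[OF emeasure_subadditive]) auto
  finally have A: "emeasure lborel A \<le> emeasure lborel ?A + e / 2" .
  have "emeasure lborel B \<le> emeasure lborel (?B \<union> {b - e / 2..b})"
    using b cInf_lower[OF _ bdd(2)] by (intro emeasure_mono) fastforce+
  also have "\<dots> \<le> emeasure lborel ?B + e / 2"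
    using \<open>0 < e\<close> by (intro order_trans[OF emeasure_subadditive]) auto
  finally have B: "emeasure lborel B \<le> emeasure lborel ?B + e / 2" .
  \<comment> \<open>The factor 2 is the Jacobian of the substitution that makes the midpoint
    \<open>c\<close> of \<open>d\<close> and a point of \<open>S\<close> the new variable.\<close>
  have half: "emeasure lborel S = 2 * (\<integral>\<^sup>+ c. indicator S (- d + 2 * c) \<partial>lborel)"
    if [measurable]: "S \<in> sets borel" for S and d :: real
    using nn_integral_real_affine[of "indicator S" 2 "- d"] that by simp
  have "emeasure lborel ?A + emeasure lborel ?B
      = 2 * (\<integral>\<^sup>+ c. indicator ?A (- b + 2 * c) + indicator ?B (- a + 2 * c) \<partial>lborel)"
    by (subst half[of ?A b], simp, subst half[of ?B a], simp)
       (subst nn_integral_add, simp_all add: distrib_left)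
  \<comment> \<open>The two indicators are never 1 together: the first forces
    \<open>c \<le> (a + b) / 2\<close>, the second the strict opposite. This is why
    \<open>?A\<close> contains its endpoint and \<open>?B\<close> does not.\<close>
  also have "\<dots> \<le> 2 * (\<integral>\<^sup>+ c. indicator C c \<partial>lborel)"
  proof (intro mult_left_mono nn_integral_mono)
    fix c
    show "indicator ?A (- b + 2 * c) + indicator ?B (- a + 2 * c) \<le> (indicator C c :: ennreal)"
      using mid[of "- b + 2 * c" b] mid[of a "- a + 2 * c"] a b by (auto simp: indicator_def)
  qed simp
  finally have "emeasure lborel ?A + emeasure lborel ?B \<le> 2 * emeasure lborel C" by simp
  moreover have "emeasure lborel A + emeasure lborel B
      \<le> (emeasure lborel ?A + emeasure lborel ?B) + (ennreal (e / 2) + ennreal (e / 2))"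
    using add_mono[OF A B] by (simp add: ac_simps)
  moreover have "ennreal (e / 2) + ennreal (e / 2) = ennreal e"
    using \<open>0 < e\<close> by (subst ennreal_plus[symmetric]) auto
  ultimately show "emeasure lborel A + emeasure lborel B \<le> 2 * emeasure lborel C + ennreal e"
    by (metis add_mono order_refl order_trans)
qed

text \<open>For fixed \<open>x\<close>, the \<open>t\<close> in \<open>{0..<1}\<close> with
  \<open>t * r < f x\<close> form an interval of length \<open>min 1 (f x / r)\<close>; Tonelli does
  the rest. Levels are scaled by \<open>r\<close> so that functions with different suprema can be
  compared at the same \<open>t\<close>.\<close>

lemma nn_integral_min_layer_cake:
  fixes f :: "real \<Rightarrow> ennreal" and r :: real
  assumes [measurable]: "f \<in> borel_measurable borel" and "0 < r"
  shows "(\<integral>\<^sup>+ x. min (ennreal r) (f x) \<partial>lborel)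
    = ennreal r * (\<integral>\<^sup>+ t. emeasure lborel {x. ennreal (t * r) < f x} * indicator {0..<1} t \<partial>lborel)"
proof -
  have "(\<integral>\<^sup>+ t. emeasure lborel {x. ennreal (t * r) < f x} * indicator {0..<1} t \<partial>lborel)
      = (\<integral>\<^sup>+ t. \<integral>\<^sup>+ x. indicator {x. ennreal (t * r) < f x} x * indicator {0..<1} t \<partial>lborel \<partial>lborel)"
    by (subst nn_integral_multc) auto
  also have "\<dots> = (\<integral>\<^sup>+ x. \<integral>\<^sup>+ t. indicator {x. ennreal (t * r) < f x} x * indicator {0..<1} t \<partial>lborel \<partial>lborel)"
    by (rule lborel_pair.Fubini') measurable
  finally have "ennreal r * (\<integral>\<^sup>+ t. emeasure lborel {x. ennreal (t * r) < f x} * indicator {0..<1} t \<partial>lborel)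
      = (\<integral>\<^sup>+ x. ennreal r * (\<integral>\<^sup>+ t. indicator {x. ennreal (t * r) < f x} x * indicator {0..<1} t \<partial>lborel) \<partial>lborel)"
    by (simp add: nn_integral_cmult)
  also have "\<dots> = (\<integral>\<^sup>+ x. min (ennreal r) (f x) \<partial>lborel)"
  proof (rule nn_integral_cong)
    fix x
    let ?I = "\<integral>\<^sup>+ t. indicator {x. ennreal (t * r) < f x} x * indicator {0..<1} t \<partial>lborel"
    show "ennreal r * ?I = min (ennreal r) (f x)"
    proof (cases "f x")
      case (real z)
      have "?I = (\<integral>\<^sup>+ t. indicator {0..<min 1 (z / r)} t \<partial>lborel)"
        using real \<open>0 < r\<close>
        by (intro nn_integral_cong) (auto simp: indicator_def ennreal_less_iff pos_less_divide_eq)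
      also have "\<dots> = ennreal (min 1 (z / r))"
        using real \<open>0 < r\<close> by simp
      finally have "ennreal r * ?I = ennreal (r * min 1 (z / r))"
        using real \<open>0 < r\<close> by (simp add: ennreal_mult)
      also have "r * min 1 (z / r) = min r z"
        using \<open>0 < r\<close> by (auto simp: min_def field_simps)
      finally show ?thesis using real \<open>0 < r\<close> by (simp add: min_ennreal)
    next
      case top
      have "?I = (\<integral>\<^sup>+ t. indicator {0..<1::real} t \<partial>lborel)"
        using top by (intro nn_integral_cong) (auto simp: indicator_def)
      then show ?thesis using top by simp
    qed
  qed
  finally show ?thesis by simp
qed

text \<open>The arithmetic-geometric mean inequality, squared so that no root is taken in
  \<open>ennreal\<close>.\<close>

lemma ennreal_arith_geo_mean:
  fixes a b c :: ennreal
  assumes "a + b \<le> 2 * c"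
  shows "a * b \<le> c\<^sup>2"
proof (cases c)
  case (real z)
  with assms have "a + b < top"
    by (metis ennreal_less_top ennreal_mult_less_top ennreal_numeral le_less_trans)
  then obtain x y where xy: "a = ennreal x" "0 \<le> x" "b = ennreal y" "0 \<le> y"
    by (cases a; cases b) auto
  have "ennreal (x + y) \<le> ennreal (2 * z)"
    using assms xy real by (simp add: ennreal_mult')
  then have "x + y \<le> 2 * z" using real by simp
  then have "(x + y)\<^sup>2 \<le> (2 * z)\<^sup>2"
    using xy by (intro power_mono) auto
  moreover have "(x - y)\<^sup>2 \<ge> 0" by simp
  ultimately have "x * y \<le> z\<^sup>2" by (simp add: power2_eq_square algebra_simps)
  then show ?thesis
    using xy real by (simp add: ennreal_mult[symmetric] ennreal_power)
qed (simp add: power2_eq_square ennreal_top_mult)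

text \<open>Normalise by the suprema \<open>p\<close> and \<open>q\<close>: for \<open>t < 1\<close>
  the superlevel sets of \<open>f\<close> at \<open>t * p\<close> and of \<open>g\<close> at
  \<open>t * q\<close> are both nonempty, and their midpoints lie in the superlevel set of
  \<open>h\<close> at \<open>t * r\<close>, with \<open>r\<close> the geometric mean of
  \<open>p\<close> and \<open>q\<close>. The one-dimensional Brunn-Minkowski inequality at each
  level, integrated over \<open>t\<close>, bounds a sum; the mean inequality turns it into a
  product.\<close>

lemma Prekopa_Leindler_real_bounded:
  fixes f g h :: "real \<Rightarrow> ennreal"
  assumes [measurable]: "f \<in> borel_measurable borel" "g \<in> borel_measurable borel" "h \<in> borel_measurable borel"
    and mid: "\<And>x y. f x * g y \<le> (h ((x + y) / 2))\<^sup>2"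
    and fin: "(SUP x. f x) < top" "(SUP x. g x) < top"
    and bdd: "bounded {x. f x \<noteq> 0}" "bounded {x. g x \<noteq> 0}"
  shows "(\<integral>\<^sup>+ x. f x \<partial>lborel) * (\<integral>\<^sup>+ x. g x \<partial>lborel) \<le> (\<integral>\<^sup>+ x. h x \<partial>lborel)\<^sup>2"
proof (cases "(SUP x. f x) = 0 \<or> (SUP x. g x) = 0")
  case True
  then have "(\<forall>x. f x = 0) \<or> (\<forall>x. g x = 0)"
    by (metis SUP_upper UNIV_I le_zero_eq)
  then show ?thesis by auto
next
  case False
  with fin obtain p q where p: "(SUP x. f x) = ennreal p" "0 < p" and q: "(SUP x. g x) = ennreal q" "0 < q"
    by (cases "SUP x. f x"; cases "SUP x. g x") (auto simp: less_le)
  define r where "r = sqrt (p * q)"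
  have r: "0 < r" "r\<^sup>2 = p * q" using p q by (auto simp: r_def)
  define L where "L s k t = emeasure lborel {x. ennreal (t * s) < k x} * indicator {0..<1} t"
    for s :: real and k :: "real \<Rightarrow> ennreal" and t :: real
  have [measurable]: "L s k \<in> borel_measurable borel" if [measurable]: "k \<in> borel_measurable borel" for s k
    unfolding L_def by measurable
  have fp: "f x \<le> ennreal p" and gq: "g x \<le> ennreal q" for x
    unfolding p(1)[symmetric] q(1)[symmetric] by (auto intro: SUP_upper)
  have "L p f t + L q g t \<le> 2 * L r h t" for t
  proof (cases "t \<in> {0..<1}")
    case True
    have "{x. ennreal (t * p) < f x} \<noteq> {}"
      using less_SUP_iff[of "ennreal (t * p)" f UNIV] p True by (auto simp: ennreal_less_iff)
    moreover have "{x. ennreal (t * q) < g x} \<noteq> {}"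
      using less_SUP_iff[of "ennreal (t * q)" g UNIV] q True by (auto simp: ennreal_less_iff)
    moreover have "bounded {x. ennreal (t * p) < f x}" "bounded {x. ennreal (t * q) < g x}"
      by (auto intro: bounded_subset[OF bdd(1)] bounded_subset[OF bdd(2)])
    moreover have "ennreal (t * r) < h ((a + b) / 2)" if ab: "ennreal (t * p) < f a" "ennreal (t * q) < g b" for a b
    proof (rule ccontr)
      assume "\<not> ennreal (t * r) < h ((a + b) / 2)"
      then have "(h ((a + b) / 2))\<^sup>2 \<le> (ennreal (t * r))\<^sup>2"
        by (intro power_mono) auto
      also have "\<dots> = ennreal ((t * p) * (t * q))"
        using True r p q by (simp add: ennreal_power power_mult_distrib) (simp add: power2_eq_square ac_simps)
      finally have le: "f a * g b \<le> ennreal ((t * p) * (t * q))"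
        using mid order_trans by blast
      obtain y z where yz: "f a = ennreal y" "0 \<le> y" "g b = ennreal z" "0 \<le> z"
        using fp[of a] gq[of b] by (metis ennreal_cases ennreal_neq_top top.extremum_uniqueI)
      have "t * p < y" "t * q < z" "0 \<le> t * p" "0 \<le> t * q"
        using ab yz True p q by (auto simp: ennreal_less_iff)
      then have "(t * p) * (t * q) < y * z"
        by (intro mult_strict_mono') auto
      then show False
        using le yz ennreal_le_iff[of "(t * p) * (t * q)" "y * z"] \<open>0 \<le> t * p\<close> \<open>0 \<le> t * q\<close>
        by (metis ennreal_le_iff ennreal_mult leD mult_nonneg_nonneg)
    qed
    ultimately have "emeasure lborel {x. ennreal (t * p) < f x} + emeasure lborel {x. ennreal (t * q) < g x}
        \<le> 2 * emeasure lborel {x. ennreal (t * r) < h x}"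
      by (intro midpoint_Brunn_Minkowski_real) auto
    then show ?thesis using True by (simp add: L_def)
  qed (simp add: L_def)
  then have "(\<integral>\<^sup>+ t. L p f t + L q g t \<partial>lborel) \<le> (\<integral>\<^sup>+ t. 2 * L r h t \<partial>lborel)"
    by (intro nn_integral_mono)
  then have "(\<integral>\<^sup>+ t. L p f t \<partial>lborel) + (\<integral>\<^sup>+ t. L q g t \<partial>lborel) \<le> 2 * (\<integral>\<^sup>+ t. L r h t \<partial>lborel)"
    by (simp add: nn_integral_add nn_integral_cmult)
  from mult_left_mono[OF ennreal_arith_geo_mean[OF this], of "ennreal p * ennreal q"]
  have "(ennreal p * (\<integral>\<^sup>+ t. L p f t \<partial>lborel)) * (ennreal q * (\<integral>\<^sup>+ t. L q g t \<partial>lborel))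
      \<le> ennreal p * ennreal q * (\<integral>\<^sup>+ t. L r h t \<partial>lborel)\<^sup>2"
    by (simp add: ac_simps)
  moreover have "(\<integral>\<^sup>+ x. f x \<partial>lborel) = ennreal p * (\<integral>\<^sup>+ t. L p f t \<partial>lborel)"
    using nn_integral_min_layer_cake[of f p] p fp by (simp add: L_def min_absorb2)
  moreover have "(\<integral>\<^sup>+ x. g x \<partial>lborel) = ennreal q * (\<integral>\<^sup>+ t. L q g t \<partial>lborel)"
    using nn_integral_min_layer_cake[of g q] q gq by (simp add: L_def min_absorb2)
  ultimately have "(\<integral>\<^sup>+ x. f x \<partial>lborel) * (\<integral>\<^sup>+ x. g x \<partial>lborel)
      \<le> ennreal p * ennreal q * (\<integral>\<^sup>+ t. L r h t \<partial>lborel)\<^sup>2"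
    by simp
  also have "ennreal p * ennreal q = (ennreal r)\<^sup>2"
    using p q r by (simp add: ennreal_mult[symmetric] ennreal_power)
  \<comment> \<open>Since \<open>h\<close> may exceed \<open>r\<close>, its layers recover only the
    integral of the truncated function, which is a lower bound as required.\<close>
  also have "(ennreal r)\<^sup>2 * (\<integral>\<^sup>+ t. L r h t \<partial>lborel)\<^sup>2 = (\<integral>\<^sup>+ x. min (ennreal r) (h x) \<partial>lborel)\<^sup>2"
    using nn_integral_min_layer_cake[of h r] r by (simp add: L_def power_mult_distrib)
  also have "\<dots> \<le> (\<integral>\<^sup>+ x. h x \<partial>lborel)\<^sup>2"
    by (intro power_mono nn_integral_mono) auto
  finally show ?thesis .
qed

text \<open>Cutting \<open>f\<close> and \<open>g\<close> off in height and in support only lowers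
  the left-hand side of the midpoint condition, so \<open>h\<close> can stay fixed; monotone
  convergence removes the cut-offs. Separate indices for \<open>f\<close> and \<open>g\<close> let
  the two suprema factor out of the product.\<close>

lemma Prekopa_Leindler_real:
  fixes f g h :: "real \<Rightarrow> ennreal"
  assumes [measurable]: "f \<in> borel_measurable borel" "g \<in> borel_measurable borel" "h \<in> borel_measurable borel"
    and mid: "\<And>x y. f x * g y \<le> (h ((x + y) / 2))\<^sup>2"
  shows "(\<integral>\<^sup>+ x. f x \<partial>lborel) * (\<integral>\<^sup>+ x. g x \<partial>lborel) \<le> (\<integral>\<^sup>+ x. h x \<partial>lborel)\<^sup>2"
proof -
  define T where "T k n x = min (k x) (of_nat n) * indicator {- real n..real n} x"
    for k :: "real \<Rightarrow> ennreal" and n :: nat and x :: real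
  have [measurable]: "T k n \<in> borel_measurable borel" if [measurable]: "k \<in> borel_measurable borel" for k n
    unfolding T_def by measurable
  have T_le: "T k n x \<le> k x" for k n x
    by (auto simp: T_def indicator_def)
  have T_top: "(SUP x. T k n x) < top" for k n
  proof -
    have "(SUP x. T k n x) \<le> of_nat n"
      by (intro SUP_least) (auto simp: T_def indicator_def)
    then show ?thesis using ennreal_of_nat_neq_top le_less_trans top.not_eq_extremum by blast
  qed
  have T_bdd: "bounded {x. T k n x \<noteq> 0}" for k n
    by (rule bounded_subset[OF bounded_closed_interval[of "- real n" "real n"]])
       (auto simp: T_def indicator_def split: if_splits)
  have T_SUP: "(\<integral>\<^sup>+ x. k x \<partial>lborel) = (SUP n. \<integral>\<^sup>+ x. T k n x \<partial>lborel)"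
    if [measurable]: "k \<in> borel_measurable borel" for k
  proof -
    have "incseq (T k)"
      unfolding incseq_def le_fun_def T_def
      by (auto simp: indicator_def intro: min.coboundedI2 order_trans)
    moreover have "(SUP n. T k n x) = k x" for x
    proof (rule antisym)
      obtain N :: nat where N: "\<bar>x\<bar> \<le> real N" using real_arch_simple by blast
      show "k x \<le> (SUP n. T k n x)"
      proof (cases "k x")
        case (real z)
        obtain M :: nat where "z \<le> real M" using real_arch_simple by blast
        then have "k x \<le> T k (max N M) x"
          using N real by (auto simp: T_def indicator_def ennreal_of_nat_eq_real_of_nat)
        then show ?thesis by (rule SUP_upper2[OF UNIV_I])
      next
        case top
        have "of_nat n \<le> (SUP n. T k n x)" for n
        proof -
          have "of_nat n \<le> T k (max n N) x"
            using N top by (auto simp: T_def indicator_def)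
          then show ?thesis by (rule SUP_upper2[OF UNIV_I])
        qed
        then have "(SUP n. of_nat n :: ennreal) \<le> (SUP n. T k n x)"
          by (rule SUP_least)
        then have "(SUP n. T k n x) = top"
          unfolding ennreal_SUP_of_nat_eq_top by (rule top.extremum_uniqueI)
        then show ?thesis by (simp only: top_greatest)
      qed
    qed (auto intro: SUP_least T_le)
    ultimately show ?thesis
      by (subst nn_integral_monotone_convergence_SUP[symmetric]) auto
  qed
  have "(\<integral>\<^sup>+ x. T f n x \<partial>lborel) * (\<integral>\<^sup>+ x. T g m x \<partial>lborel) \<le> (\<integral>\<^sup>+ x. h x \<partial>lborel)\<^sup>2" for n m
  proof (rule Prekopa_Leindler_real_bounded)
    show "T f n x * T g m y \<le> (h ((x + y) / 2))\<^sup>2" for x y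
      by (rule order_trans[OF mult_mono[OF T_le T_le] mid]) auto
  qed (use T_top T_bdd in auto)
  then have "(SUP m. SUP n. (\<integral>\<^sup>+ x. T f n x \<partial>lborel) * (\<integral>\<^sup>+ x. T g m x \<partial>lborel)) \<le> (\<integral>\<^sup>+ x. h x \<partial>lborel)\<^sup>2"
    by (intro SUP_least)
  then show ?thesis
    by (simp add: T_SUP[of f] T_SUP[of g] SUP_mult_left_ennreal SUP_mult_right_ennreal)
qed

text \<open>Induction on the dimension: the one-dimensional inequality for the slices over
  \<open>x\<close>, \<open>y\<close> and their midpoint is exactly the midpoint condition for the
  slice integrals. Points are taken extensional, and midpoints restricted to \<open>I\<close>, to
  stay in the space of the product measure.\<close>

lemma Prekopa_Leindler_PiM:
  fixes f g h :: "('i \<Rightarrow> real) \<Rightarrow> ennreal"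
  assumes "finite I"
    and "f \<in> borel_measurable (\<Pi>\<^sub>M i\<in>I. lborel)" "g \<in> borel_measurable (\<Pi>\<^sub>M i\<in>I. lborel)"
      "h \<in> borel_measurable (\<Pi>\<^sub>M i\<in>I. lborel)"
    and "\<And>x y. x \<in> extensional I \<Longrightarrow> y \<in> extensional I \<Longrightarrow> f x * g y \<le> (h (\<lambda>i\<in>I. (x i + y i) / 2))\<^sup>2"
  shows "(\<integral>\<^sup>+ x. f x \<partial>(\<Pi>\<^sub>M i\<in>I. lborel)) * (\<integral>\<^sup>+ x. g x \<partial>(\<Pi>\<^sub>M i\<in>I. lborel))
    \<le> (\<integral>\<^sup>+ x. h x \<partial>(\<Pi>\<^sub>M i\<in>I. lborel))\<^sup>2"
  using assms
proof (induction I arbitrary: f g h rule: finite_induct)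
  case empty
  \<comment> \<open>The empty product is the unit mass at \<open>\<lambda>_. undefined\<close>, the
    only extensional function, so the midpoint condition there is the claim.\<close>
  then show ?case
    using empty.prems(4)[of "\<lambda>_. undefined" "\<lambda>_. undefined"]
    by (simp add: PiM_empty nn_integral_count_space_finite restrict_def)
next
  case (insert j I)
  interpret product_sigma_finite "\<lambda>_::'i. lborel :: real measure" ..
  note [measurable] = insert.prems(1-3)
  have upd: "(\<lambda>t. k (x(j := t))) \<in> borel_measurable borel"
    if "k \<in> borel_measurable (\<Pi>\<^sub>M i\<in>insert j I. lborel)" "x \<in> extensional I" for k :: "('i \<Rightarrow> real) \<Rightarrow> ennreal" and x
    using measurable_comp[OF measurable_component_update[of x I "\<lambda>_. lborel" j] that(1)] that(2) insert.hyps
    by (simp add: space_PiM comp_def PiE_def)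
  have "(\<integral>\<^sup>+ x. (\<integral>\<^sup>+ t. f (x(j := t)) \<partial>lborel) \<partial>(\<Pi>\<^sub>M i\<in>I. lborel)) * (\<integral>\<^sup>+ x. (\<integral>\<^sup>+ t. g (x(j := t)) \<partial>lborel) \<partial>(\<Pi>\<^sub>M i\<in>I. lborel))
    \<le> (\<integral>\<^sup>+ x. (\<integral>\<^sup>+ t. h (x(j := t)) \<partial>lborel) \<partial>(\<Pi>\<^sub>M i\<in>I. lborel))\<^sup>2"
  proof (rule insert.IH)
    fix x y :: "'i \<Rightarrow> real"
    assume x: "x \<in> extensional I" and y: "y \<in> extensional I"
    show "(\<integral>\<^sup>+ t. f (x(j := t)) \<partial>lborel) * (\<integral>\<^sup>+ t. g (y(j := t)) \<partial>lborel)
      \<le> (\<integral>\<^sup>+ t. h ((\<lambda>i\<in>I. (x i + y i) / 2)(j := t)) \<partial>lborel)\<^sup>2"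
    proof (rule Prekopa_Leindler_real)
      fix s t
      have mid: "(\<lambda>i\<in>insert j I. ((x(j := s)) i + (y(j := t)) i) / 2) = (\<lambda>i\<in>I. (x i + y i) / 2)(j := (s + t) / 2)"
        using insert.hyps by (auto simp: fun_eq_iff restrict_def)
      have "x(j := s) \<in> extensional (insert j I)" "y(j := t) \<in> extensional (insert j I)"
        using x y by (auto simp: extensional_def)
      from insert.prems(4)[OF this]
      show "f (x(j := s)) * g (y(j := t)) \<le> (h ((\<lambda>i\<in>I. (x i + y i) / 2)(j := (s + t) / 2)))\<^sup>2"
        unfolding mid .
    qed (use x y upd insert.prems in auto)
  qed measurable
  then show ?case
    by (simp only: product_nn_integral_insert[OF insert.hyps] insert.prems(1-3))
qed

text \<open>Lebesgue measure is the image of the product measure over \<open>Basis\<close> under the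
  linear map \<open>S\<close>, which preserves midpoints.\<close>

theorem Prekopa_Leindler:
  fixes f g h :: "'a::euclidean_space \<Rightarrow> ennreal"
  assumes [measurable]: "f \<in> borel_measurable borel" "g \<in> borel_measurable borel" "h \<in> borel_measurable borel"
    and mid: "\<And>x y. f x * g y \<le> (h ((1 / 2) *\<^sub>R (x + y)))\<^sup>2"
  shows "(\<integral>\<^sup>+ x. f x \<partial>lborel) * (\<integral>\<^sup>+ x. g x \<partial>lborel) \<le> (\<integral>\<^sup>+ x. h x \<partial>lborel)\<^sup>2"
proof -
  define S :: "('a \<Rightarrow> real) \<Rightarrow> 'a" where "S x = (\<Sum>b\<in>Basis. x b *\<^sub>R b)" for x
  have [measurable]: "S \<in> borel_measurable (\<Pi>\<^sub>M b\<in>Basis. lborel)"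
    unfolding S_def by measurable
  have eq: "(\<integral>\<^sup>+ x. k x \<partial>lborel) = (\<integral>\<^sup>+ x. k (S x) \<partial>(\<Pi>\<^sub>M b\<in>Basis. lborel))"
    if [measurable]: "k \<in> borel_measurable borel" for k :: "'a \<Rightarrow> ennreal"
    by (subst lborel_eq) (simp add: nn_integral_distr S_def[abs_def, symmetric])
  have "S (\<lambda>i\<in>Basis. (x i + y i) / 2) = (1 / 2) *\<^sub>R (S x + S y)" for x y
    by (simp add: S_def scaleR_sum_right scaleR_add_left flip: sum.distrib)
       (simp add: scaleR_add_right add_divide_distrib scaleR_add_left)
  then show ?thesis
    unfolding eq[OF assms(1)] eq[OF assms(2)] eq[OF assms(3)]
    by (intro Prekopa_Leindler_PiM) (auto intro: mid)
qed

section \<open>Gruenbaum's inequality\<close>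

text \<open>Let \<open>d\<close> be the difference between \<open>f\<close> and its chord, as a
  function on \<open>{0..1}\<close>. If its maximum were positive, the leftmost maximiser
  \<open>q\<close> would be an inner point; midpoint convexity around \<open>q\<close> would then
  bound the maximum by the average of a strictly smaller value on the left and a value on the right
  that is at most the maximum.\<close>

lemma midpoint_convex_imp_convex_on:
  fixes f :: "'a::real_normed_vector \<Rightarrow> real"
  assumes "convex S" "continuous_on S f"
    and mid: "\<And>x y. x \<in> S \<Longrightarrow> y \<in> S \<Longrightarrow> f ((1 / 2) *\<^sub>R (x + y)) \<le> (f x + f y) / 2"
  shows "convex_on S f"
proof (rule convex_onI)
  fix t :: real and x y
  assume t: "0 < t" "t < 1" and x: "x \<in> S" and y: "y \<in> S"
  define l where "l s = (1 - s) *\<^sub>R x + s *\<^sub>R y" for s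
  define d where "d s = f (l s) - ((1 - s) * f x + s * f y)" for s
  have lS: "l s \<in> S" if "s \<in> {0..1}" for s
    using convexD_alt[OF \<open>convex S\<close> x y] that by (auto simp: l_def)
  have "continuous_on {0..1} l" unfolding l_def by (intro continuous_intros)
  then have "continuous_on {0..1} (\<lambda>s. f (l s))"
    using lS by (intro continuous_on_compose2[OF \<open>continuous_on S f\<close>]) auto
  then have cont: "continuous_on {0..1} d"
    unfolding d_def by (intro continuous_intros)
  have mid_d: "d ((r + s) / 2) \<le> (d r + d s) / 2" if "r \<in> {0..1}" "s \<in> {0..1}" for r s
  proof -
    have "l ((r + s) / 2) = (1 / 2) *\<^sub>R (l r + l s)"
      by (simp add: l_def algebra_simps flip: scaleR_add_left)
    with mid[OF lS[OF that(1)] lS[OF that(2)]] show ?thesis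
      by (simp add: d_def field_simps)
  qed
  obtain p where p: "p \<in> {0..1}" "\<And>s. s \<in> {0..1} \<Longrightarrow> d s \<le> d p"
    using continuous_attains_sup[OF compact_Icc _ cont] by auto
  have "d p \<le> 0"
  proof (rule ccontr)
    assume "\<not> d p \<le> 0"
    define Z where "Z = {s \<in> {0..1}. d s = d p}"
    have "closed Z"
      unfolding Z_def using continuous_closed_preimage_constant[OF cont closed_atLeastAtMost] .
    moreover have "Z \<noteq> {}" "bdd_below Z"
      using p(1) by (auto simp: Z_def intro: bdd_belowI[of _ 0])
    ultimately have "Inf Z \<in> Z" by (intro closed_contains_Inf)
    define q where "q = Inf Z"
    have q: "q \<in> {0..1}" "d q = d p" using \<open>Inf Z \<in> Z\<close> by (auto simp: Z_def q_def)
    have "d 0 = 0" "d 1 = 0" by (auto simp: d_def l_def)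
    with q \<open>\<not> d p \<le> 0\<close> have "q \<noteq> 0" "q \<noteq> 1" by auto
    with q have "0 < q" "q < 1" by auto
    define e where "e = min q (1 - q)"
    have e: "0 < e" "q - e \<in> {0..1}" "q + e \<in> {0..1}"
      using \<open>0 < q\<close> \<open>q < 1\<close> by (auto simp: e_def)
    have "q - e \<notin> Z"
      using cInf_lower[OF _ \<open>bdd_below Z\<close>, of "q - e"] e by (auto simp: q_def)
    then have "d (q - e) < d p" using p(2)[of "q - e"] e by (auto simp: Z_def)
    moreover have "d (q + e) \<le> d p" using p(2) e by auto
    moreover have "d q \<le> (d (q - e) + d (q + e)) / 2"
      using mid_d[OF e(2,3)] by simp
    ultimately show False using q by simp
  qed
  then have "d t \<le> 0" using p(2)[of t] t by simp
  then show "f ((1 - t) *\<^sub>R x + t *\<^sub>R y) \<le> (1 - t) * f x + t * f y"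
    by (simp add: d_def l_def)
qed (rule \<open>convex S\<close>)

text \<open>The area under the distribution function on \<open>{a..b}\<close> is
  \<open>I * (b - m)\<close>. Suppose \<open>cdf M m\<close> is at most \<open>I / e\<close>. The
  supporting exponential of rate \<open>k\<close> at \<open>m\<close> then reaches the height
  \<open>I\<close> at a point \<open>c\<close> with \<open>k * (c - m) \<ge> 1\<close>. Bounding
  \<open>cdf M\<close> by this exponential up to \<open>c\<close> and by \<open>I\<close> beyond
  makes the area less than \<open>I / k + I * (b - c)\<close>, hence \<open>k * (c - m) < 1\<close>,
  a contradiction. Log-concavity is assumed in product form, which is meaningful where
  \<open>cdf M\<close> vanishes.\<close>

lemma (in finite_borel_measure) cdf_mean_gt:
  fixes a b :: real
  defines "I \<equiv> measure M (space M)"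
  defines "m \<equiv> (\<integral>x. x \<partial>M) / I"
  assumes atomless: "\<And>x. measure M {x} = 0"
    and mid: "\<And>x y. cdf M x * cdf M y \<le> (cdf M ((x + y) / 2))\<^sup>2"
    and supp: "AE x in M. a \<le> x \<and> x \<le> b"
    and "0 < I"
  shows "exp (- 1) * I < cdf M m"
proof -
  note M_is_borel[measurable_cong]
  interpret P: pair_sigma_finite M lborel ..
  have sp: "space M = UNIV" by (rule borel_UNIV)
  have int: "integrable M (\<lambda>x. x)"
    using supp by (intro integrable_const_bound[of _ "max \<bar>a\<bar> \<bar>b\<bar>"]) auto
  have Im: "I * m = (\<integral>x. x \<partial>M)" using \<open>0 < I\<close> by (simp add: m_def)
  have "I * a \<le> I * m" "I * m \<le> I * b"
    using integral_mono_AE[OF integrable_const int, of a] integral_mono_AE[OF int integrable_const, of b] supp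
    unfolding Im by (auto simp: I_def)
  then have m: "a \<le> m" "m \<le> b" using \<open>0 < I\<close> by auto
  have cont: "isCont (cdf M) x" for x
    using isCont_cdf atomless by simp
  have F_le: "cdf M t \<le> I" for t
    unfolding I_def by (rule cdf_bounded)
  have Fb: "cdf M b = I"
    unfolding cdf_def I_def using supp by (intro finite_measure_eq_AE) (auto simp: sp)
  \<comment> \<open>Here \<open>b - x\<close> is the length of \<open>{x..b}\<close>; exchanging the
    integrals leaves, for each \<open>t\<close>, the mass of the points
    \<open>x \<le> t\<close>.\<close>
  have Fubini: "ennreal (I * (b - m)) = (\<integral>\<^sup>+ t. ennreal (cdf M t) * indicator {a..b} t \<partial>lborel)"
  proof -
    have "I * (b - m) = (\<integral>x. b - x \<partial>M)"
      using int by (simp add: Im[symmetric] right_diff_distrib I_def)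
    also have "ennreal \<dots> = (\<integral>\<^sup>+ x. ennreal (b - x) \<partial>M)"
      using int supp by (intro nn_integral_eq_integral[symmetric]) auto
    also have "\<dots> = (\<integral>\<^sup>+ x. (\<integral>\<^sup>+ t. indicator {x..} t * indicator {a..b} t \<partial>lborel) \<partial>M)"
    proof (rule nn_integral_cong_AE, use supp in eventually_elim)
      fix x assume x: "a \<le> x \<and> x \<le> b"
      have "(\<integral>\<^sup>+ t. indicator {x..} t * indicator {a..b} t \<partial>lborel) = (\<integral>\<^sup>+ t. indicator {x..b} t \<partial>lborel)"
        using x by (intro nn_integral_cong) (auto simp: indicator_def)
      then show "ennreal (b - x) = (\<integral>\<^sup>+ t. indicator {x..} t * indicator {a..b} t \<partial>lborel)"
        using x by simp
    qed
    also have "\<dots> = (\<integral>\<^sup>+ t. (\<integral>\<^sup>+ x. indicator {x..} t * indicator {a..b} t \<partial>M) \<partial>lborel)"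
      unfolding indicator_def atLeast_iff by (rule P.Fubini'[symmetric]) measurable
    also have "\<dots> = (\<integral>\<^sup>+ t. ennreal (cdf M t) * indicator {a..b} t \<partial>lborel)"
    proof (rule nn_integral_cong)
      fix t
      have "(\<integral>\<^sup>+ x. indicator {x..} t * indicator {a..b} t \<partial>M)
          = (\<integral>\<^sup>+ x. indicator {a..b} t * indicator {..t} x \<partial>M)"
        by (intro nn_integral_cong) (auto simp: indicator_def)
      also have "\<dots> = indicator {a..b} t * ennreal (cdf M t)"
        by (subst nn_integral_cmult_indicator) (auto simp: cdf_def emeasure_eq_measure)
      finally show "(\<integral>\<^sup>+ x. indicator {x..} t * indicator {a..b} t \<partial>M) = ennreal (cdf M t) * indicator {a..b} t"
        by (simp add: mult.commute)
    qed
    finally show ?thesis .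
  qed
  \<comment> \<open>Otherwise all mass would lie strictly above \<open>m\<close>, although
    \<open>x - m\<close> has integral zero.\<close>
  have pos: "0 < cdf M m"
  proof (rule ccontr)
    assume "\<not> 0 < cdf M m"
    then have "measure M {..m} = 0" by (simp add: cdf_def zero_less_measure_iff)
    then have "{..m} \<in> null_sets M"
      by (simp add: null_sets_def emeasure_eq_measure M_is_borel)
    then have gt: "AE x in M. m < x" by (rule AE_I') auto
    have "(\<integral>x. x - m \<partial>M) = 0" using int by (simp add: Im[symmetric] I_def)
    then have "AE x in M. x - m = 0"
      using gt int by (subst (asm) integral_nonneg_eq_0_iff_AE) auto
    with gt have "AE x in M. False" by eventually_elim simp
    then have "measure M (space M) = measure M {}" by (intro finite_measure_eq_AE) auto
    then show False using \<open>0 < I\<close> by (simp add: I_def)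
  qed
  \<comment> \<open>Logarithms are taken only on \<open>S\<close>, an open interval unbounded to the
    right, as \<open>cdf M\<close> is continuous and nondecreasing.\<close>
  define S where "S = {t. 0 < cdf M t}"
  have up: "y \<in> S" if "x \<in> S" "x \<le> y" for x y
    using that cdf_nondecreasing[of x y] by (auto simp: S_def)
  have "open S"
    unfolding S_def using cont by (intro open_Collect_less continuous_intros continuous_at_imp_continuous_on) auto
  have "convex S"
    unfolding is_interval_convex_1[symmetric] is_interval_1 using up by blast
  have "convex_on S (\<lambda>t. - ln (cdf M t))"
  proof (rule midpoint_convex_imp_convex_on[OF \<open>convex S\<close>])
    show "continuous_on S (\<lambda>t. - ln (cdf M t))"
      using cont by (intro continuous_intros continuous_at_imp_continuous_on) (auto simp: S_def)
    fix x y assume xy: "x \<in> S" "y \<in> S"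
    then have "ln (cdf M x * cdf M y) \<le> ln ((cdf M ((x + y) / 2))\<^sup>2)"
      by (intro ln_mono mid) (auto simp: S_def)
    moreover have "(x + y) / 2 \<in> S"
      using xy up[of x "(x + y) / 2"] up[of y "(x + y) / 2"] by (cases "x \<le> y") auto
    ultimately show "- ln (cdf M ((1 / 2) *\<^sub>R (x + y))) \<le> (- ln (cdf M x) + - ln (cdf M y)) / 2"
      using xy by (simp add: S_def ln_mult ln_realpow)
  qed
  moreover have "m \<in> interior S" using pos \<open>open S\<close> by (simp add: interior_open S_def)
  ultimately have sub: "- ln (cdf M t) \<ge> - ln (cdf M m)
      + Inf ((\<lambda>s. (- ln (cdf M m) - - ln (cdf M s)) / (m - s)) ` ({m<..} \<inter> S)) * (t - m)" if "t \<in> S" for t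
    using that by (rule convex_le_Inf_differential)
  \<comment> \<open>The infimum of the right difference quotients is a subgradient of the convex
    function \<open>- ln (cdf M t)\<close> at \<open>m\<close>; its negative is the rate of the
    supporting exponential.\<close>
  define k where "k = - Inf ((\<lambda>s. (- ln (cdf M m) - - ln (cdf M s)) / (m - s)) ` ({m<..} \<inter> S))"
  have k: "ln (cdf M t) \<le> ln (cdf M m) + k * (t - m)" if "0 < cdf M t" for t
    using sub[of t] that by (simp add: k_def S_def)
  show ?thesis
  proof (rule ccontr)
    assume "\<not> exp (- 1) * I < cdf M m"
    then have "ln (cdf M m) \<le> ln (exp (- 1) * I)"
      using pos by (intro ln_mono) auto
    then have g: "1 \<le> ln I - ln (cdf M m)" using \<open>0 < I\<close> by (simp add: ln_mult)
    \<comment> \<open>At \<open>b\<close> the distribution function has its full value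
      \<open>I\<close>, so the supporting line must rise by at least 1 between \<open>m\<close> and
      \<open>b\<close>.\<close>
    have kb: "1 \<le> k * (b - m)" using k[of b] Fb \<open>0 < I\<close> g by simp
    have "0 < k"
    proof (rule ccontr)
      assume "\<not> 0 < k"
      then have "k * (b - m) \<le> 0" using m by (intro mult_nonpos_nonneg) auto
      with kb show False by simp
    qed
    \<comment> \<open>At \<open>c\<close> the supporting exponential reaches \<open>I\<close>; at
      \<open>b\<close> it is at least \<open>I\<close>, so \<open>c\<close> lies between
      \<open>m\<close> and \<open>b\<close>.\<close>
    define c where "c = m + (ln I - ln (cdf M m)) / k"
    have kc: "k * (c - m) = ln I - ln (cdf M m)" using \<open>0 < k\<close> by (simp add: c_def)
    have "m \<le> c" using g \<open>0 < k\<close> by (simp add: c_def)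
    have "k * (c - m) \<le> k * (b - m)" using k[of b] Fb \<open>0 < I\<close> kc by simp
    then have "c \<le> b" using \<open>0 < k\<close> by simp
    have tail: "cdf M t \<le> I * exp (k * (t - c))" for t
    proof (cases "0 < cdf M t")
      case True
      have "ln (cdf M t) \<le> ln I + k * (t - c)"
        using k[OF True] kc by (simp add: algebra_simps)
      then have "exp (ln (cdf M t)) \<le> exp (ln I + k * (t - c))" by simp
      then show ?thesis using True \<open>0 < I\<close> by (simp add: exp_add)
    qed (use \<open>0 < I\<close> in \<open>auto simp: not_less intro: order_trans\<close>)
    have "k * (a - c) \<le> 0"
      using m \<open>m \<le> c\<close> \<open>0 < k\<close> by (intro mult_nonneg_nonpos) auto
    then have "I * exp (k * (a - c)) / k \<le> I / k"
      using \<open>0 < I\<close> \<open>0 < k\<close> by (intro divide_right_mono mult_left_le) auto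
    have "(\<integral>\<^sup>+ t. ennreal (cdf M t) * indicator {a..b} t \<partial>lborel)
      \<le> (\<integral>\<^sup>+ t. ennreal (I * exp (k * (t - c))) * indicator {a..c} t + ennreal I * indicator {c..b} t \<partial>lborel)"
      using tail F_le by (intro nn_integral_mono) (auto simp: indicator_def intro!: ennreal_leI add_increasing2 add_increasing)
    also have "\<dots> = (\<integral>\<^sup>+ t. ennreal (I * exp (k * (t - c))) * indicator {a..c} t \<partial>lborel) + ennreal I * ennreal (b - c)"
      using \<open>c \<le> b\<close> by (subst nn_integral_add) (auto simp: nn_integral_cmult)
    also have "(\<integral>\<^sup>+ t. ennreal (I * exp (k * (t - c))) * indicator {a..c} t \<partial>lborel)
        = ennreal (I / k * exp (k * (c - c)) - I / k * exp (k * (a - c)))"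
      using m \<open>m \<le> c\<close> \<open>0 < I\<close> \<open>0 < k\<close>
      by (intro nn_integral_FTC_Icc) (auto intro!: derivative_eq_intros)
    also have "\<dots> + ennreal I * ennreal (b - c) = ennreal (I / k - I / k * exp (k * (a - c)) + I * (b - c))"
      using \<open>c \<le> b\<close> \<open>0 < I\<close> \<open>I * exp (k * (a - c)) / k \<le> I / k\<close>
      by (subst ennreal_mult'[symmetric], simp, subst ennreal_plus[symmetric]) auto
    finally have "ennreal (I * (b - m)) \<le> ennreal (I / k - I / k * exp (k * (a - c)) + I * (b - c))"
      unfolding Fubini .
    moreover have "0 < I * (b - m)" using kb \<open>0 < k\<close> \<open>0 < I\<close> m by (auto simp: less_le)
    ultimately have "I * (b - m) \<le> I / k - I / k * exp (k * (a - c)) + I * (b - c)"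
      by (metis ennreal_le_iff2 not_less)
    \<comment> \<open>The strictness comes from here: the dropped term is the area under the
      exponential to the left of \<open>a\<close>, where there is no mass.\<close>
    also have "\<dots> < I / k + I * (b - c)" using \<open>0 < I\<close> \<open>0 < k\<close> by simp
    finally have "I * (k * (c - m)) < I * 1" using \<open>0 < k\<close> by (simp add: field_simps)
    then show False using \<open>0 < I\<close> kc g by simp
  qed
qed

section \<open>Marginals of a weight along a linear functional\<close>

lemma borel_measurable_lebesgue_inner [measurable]:
  fixes u :: "'a::euclidean_space"
  shows "(\<lambda>x. u \<bullet> x) \<in> borel_measurable lebesgue"
  by (intro measurable_completion) simp

definition marginal :: "'a::euclidean_space set \<Rightarrow> ('a \<Rightarrow> real) \<Rightarrow> 'a \<Rightarrow> real measure" where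
  "marginal L \<phi> u = distr (density lebesgue (\<lambda>x. ennreal (indicator L x * \<phi> x))) borel (\<lambda>x. u \<bullet> x)"

locale weighted_set =
  fixes L :: "'a::euclidean_space set" and \<phi> :: "'a \<Rightarrow> real"
  assumes L: "L \<in> sets lebesgue" and nonneg: "\<And>x. x \<in> L \<Longrightarrow> 0 \<le> \<phi> x"
    and integrable: "set_integrable lebesgue L \<phi>"
begin

lemma weight_measurable [measurable]: "(\<lambda>x. indicator L x * \<phi> x) \<in> borel_measurable lebesgue"
  using borel_measurable_integrable[OF integrable[unfolded set_integrable_def]] by simp

lemma weight_nonneg: "0 \<le> indicator L x * \<phi> x"
  using nonneg by (simp add: indicator_def)

lemma emeasure_marginal:
  assumes [measurable]: "B \<in> sets borel"
  shows "emeasure (marginal L \<phi> u) B = (\<integral>\<^sup>+ x. ennreal (indicator (L \<inter> {x. u \<bullet> x \<in> B}) x * \<phi> x) \<partial>lebesgue)"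
proof -
  have [measurable]: "{x. u \<bullet> x \<in> B} \<in> sets lebesgue"
    using measurable_sets[OF borel_measurable_lebesgue_inner assms] by (simp add: vimage_def)
  have "emeasure (marginal L \<phi> u) B = (\<integral>\<^sup>+ x. ennreal (indicator L x * \<phi> x) * indicator {x. u \<bullet> x \<in> B} x \<partial>lebesgue)"
    by (simp add: marginal_def emeasure_distr emeasure_density vimage_def)
  also have "\<dots> = (\<integral>\<^sup>+ x. ennreal (indicator (L \<inter> {x. u \<bullet> x \<in> B}) x * \<phi> x) \<partial>lebesgue)"
    by (intro nn_integral_cong) (auto simp: indicator_def)
  finally show ?thesis .
qed

lemma integrable_section:
  assumes "B \<in> sets borel"
  shows "set_integrable lebesgue (L \<inter> {x. u \<bullet> x \<in> B}) \<phi>"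
proof (rule set_integrable_subset[OF integrable])
  have "{x. u \<bullet> x \<in> B} \<in> sets lebesgue"
    using measurable_sets[OF borel_measurable_lebesgue_inner assms] by (simp add: vimage_def)
  then show "L \<inter> {x. u \<bullet> x \<in> B} \<in> sets lebesgue" using L by auto
qed auto

lemma emeasure_marginal_eq_integral:
  assumes "B \<in> sets borel"
  shows "emeasure (marginal L \<phi> u) B = ennreal (set_lebesgue_integral lebesgue (L \<inter> {x. u \<bullet> x \<in> B}) \<phi>)"
  unfolding emeasure_marginal[OF assms]
  using integrable_section[OF assms, of u] nonneg
  by (subst nn_integral_eq_integral) (auto simp: set_integrable_def set_lebesgue_integral_def indicator_def)

lemma measure_marginal:
  assumes "B \<in> sets borel"
  shows "measure (marginal L \<phi> u) B = set_lebesgue_integral lebesgue (L \<inter> {x. u \<bullet> x \<in> B}) \<phi>"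
proof -
  have "0 \<le> set_lebesgue_integral lebesgue (L \<inter> {x. u \<bullet> x \<in> B}) \<phi>"
    unfolding set_lebesgue_integral_def using nonneg by (intro Bochner_Integration.integral_nonneg) (auto simp: indicator_def)
  then show ?thesis
    by (simp add: measure_def emeasure_marginal_eq_integral[OF assms])
qed

lemma finite_borel_marginal: "finite_borel_measure (marginal L \<phi> u)"
proof (intro finite_borel_measure.intro finite_measureI finite_borel_measure_axioms.intro)
  have "space (marginal L \<phi> u) = UNIV" by (simp add: marginal_def)
  then show "emeasure (marginal L \<phi> u) (space (marginal L \<phi> u)) \<noteq> \<infinity>"
    by (simp add: emeasure_marginal_eq_integral)
qed (simp add: marginal_def)

lemma integral_marginal:
  "(\<integral>t. t \<partial>marginal L \<phi> u) = set_lebesgue_integral lebesgue L (\<lambda>x. \<phi> x * (u \<bullet> x))"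
  unfolding marginal_def set_lebesgue_integral_def
  by (subst integral_distr, simp, simp, subst integral_real_density)
     (auto simp: weight_nonneg mult.assoc)

text \<open>An atom would be the weight of a hyperplane, which is Lebesgue null.\<close>

lemma marginal_atomless:
  assumes "u \<noteq> 0"
  shows "measure (marginal L \<phi> u) {c} = 0"
proof -
  have "negligible {x. u \<bullet> x = c}" using assms by (simp add: negligible_hyperplane)
  then have "AE x in lebesgue. x \<notin> {x. u \<bullet> x = c}"
    by (intro AE_not_in) (simp only: negligible_iff_null_sets)
  then have "AE x in lebesgue. indicator (L \<inter> {x. u \<bullet> x \<in> {c}}) x *\<^sub>R \<phi> x = 0"
    by eventually_elim (auto simp: indicator_def)
  then show ?thesis
    by (simp add: measure_marginal set_lebesgue_integral_def integral_eq_zero_AE)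
qed

text \<open>The weight of an upper half-space is the distribution function in direction
  \<open>- u\<close> at \<open>- c\<close>, which is continuous because there are no atoms.\<close>

lemma isCont_tail:
  assumes "u \<noteq> 0"
  shows "isCont (\<lambda>c. set_lebesgue_integral lebesgue (L \<inter> {x. u \<bullet> x \<ge> c}) \<phi>) c"
proof -
  interpret finite_borel_measure "marginal L \<phi> (- u)" by (rule finite_borel_marginal)
  have "isCont (cdf (marginal L \<phi> (- u))) (- c)"
    using isCont_cdf marginal_atomless[of "- u"] assms by simp
  then have "isCont (\<lambda>c. cdf (marginal L \<phi> (- u)) (- c)) c"
    by (rule isCont_o2[rotated]) simp
  then show ?thesis
    by (simp add: cdf_def measure_marginal)
qed

end

section \<open>Gruenbaum's inequality for log-concave weights\<close>

lemma log_concave_midpoint: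
  fixes \<phi> :: "'a::real_vector \<Rightarrow> real"
  assumes "concave_on S (\<lambda>x. ln (\<phi> x))" "\<And>x. x \<in> S \<Longrightarrow> 0 < \<phi> x" "x \<in> S" "y \<in> S"
  shows "\<phi> x * \<phi> y \<le> (\<phi> ((1 / 2) *\<^sub>R (x + y)))\<^sup>2"
proof -
  let ?z = "(1 / 2) *\<^sub>R (x + y)"
  have "convex S" using assms(1) by (simp add: concave_on_def convex_on_imp_convex)
  from convexD_alt[OF this assms(3,4), of "1 / 2"] have z: "?z \<in> S"
    by (simp add: scaleR_add_right)
  have "(1 - 1 / 2) * ln (\<phi> x) + 1 / 2 * ln (\<phi> y) \<le> ln (\<phi> ((1 - 1 / 2) *\<^sub>R x + (1 / 2) *\<^sub>R y))"
    using convex_onD[of S "\<lambda>x. - ln (\<phi> x)" "1 / 2" x y] assms by (simp add: concave_on_def)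
  then have "ln (\<phi> x) + ln (\<phi> y) \<le> 2 * ln (\<phi> ?z)"
    by (simp add: scaleR_add_right)
  moreover have p: "0 < \<phi> x" "0 < \<phi> y" "0 < \<phi> ?z"
    using assms(2-4) z by auto
  ultimately have "ln (\<phi> x * \<phi> y) \<le> ln ((\<phi> ?z)\<^sup>2)"
    by (simp add: ln_mult ln_realpow)
  then show ?thesis
    using p by (subst (asm) ln_le_cancel_iff) auto
qed

text \<open>The weight cut by the half-spaces at \<open>s\<close>, \<open>t\<close> and
  \<open>(s + t) / 2\<close> satisfies the midpoint condition of \<open>Prekopa_Leindler\<close>, so
  the marginal in direction \<open>u\<close> has a log-concave distribution function. Its mean is
  the threshold in the claim, and \<open>cdf_mean_gt\<close> applies.\<close>

theorem Gruenbaum_log_concave: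
  fixes L :: "'a::euclidean_space set" and \<phi> :: "'a \<Rightarrow> real" and u :: 'a
  defines "I \<equiv> set_lebesgue_integral lebesgue L \<phi>"
  assumes "convex L" "bounded L" and pos: "\<And>x. x \<in> L \<Longrightarrow> 0 < \<phi> x"
    and int: "set_integrable lebesgue L \<phi>" and conc: "concave_on L (\<lambda>x. ln (\<phi> x))"
    and "u \<noteq> 0" "0 < I"
  shows "exp (- 1) * I
    < set_lebesgue_integral lebesgue (L \<inter> {x. u \<bullet> x \<le> set_lebesgue_integral lebesgue L (\<lambda>x. \<phi> x * (u \<bullet> x)) / I}) \<phi>"
proof -
  have "L \<in> sets lebesgue"
    using measurable_convex[OF assms(2,3)] by (simp add: fmeasurable_def)
  then interpret weighted_set L \<phi>
    using pos int by unfold_locales (auto intro: less_imp_le)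
  let ?M = "marginal L \<phi> u"
  interpret finite_borel_measure ?M by (rule finite_borel_marginal)
  \<comment> \<open>On the open set \<open>U\<close> the weight is continuous, since
    \<open>ln (\<phi> x)\<close> is concave there; hence \<open>w\<close> is Borel, as
    \<open>Prekopa_Leindler\<close> requires. The removed part lies in the frontier of a convex set
    and is null.\<close>
  define U where "U = interior L"
  define w where "w x = ennreal (indicator U x * \<phi> x)" for x
  have U: "open U" "convex U" "U \<subseteq> L"
    using \<open>convex L\<close> by (auto simp: U_def convex_interior interior_subset)
  have concU: "concave_on U (\<lambda>x. ln (\<phi> x))"
    using conc U by (auto simp: concave_on_def intro: convex_on_subset)
  have "continuous_on U (\<lambda>x. - ln (\<phi> x))"
    using concU U by (intro convex_on_continuous) (auto simp: concave_on_def)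
  from continuous_on_exp[OF continuous_on_minus[OF this]] have "continuous_on U \<phi>"
    by (rule continuous_on_eq) (use U pos in auto)
  then have "(\<lambda>x. indicator U x *\<^sub>R \<phi> x) \<in> borel_measurable borel"
    using U by (intro borel_measurable_continuous_on_indicator) auto
  then have [measurable]: "w \<in> borel_measurable borel"
    unfolding w_def by simp
  have w_mid: "w x * w y \<le> (w ((1 / 2) *\<^sub>R (x + y)))\<^sup>2" for x y
  proof (cases "x \<in> U \<and> y \<in> U")
    case True
    then have "(1 / 2) *\<^sub>R (x + y) \<in> U"
      using convexD_alt[OF U(2), of x y "1 / 2"] by (simp add: scaleR_add_right)
    then show ?thesis
      using True U pos log_concave_midpoint[OF concU, of x y]
      by (auto simp: w_def ennreal_mult[symmetric] ennreal_power less_imp_le subset_iff)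
  qed (auto simp: w_def indicator_def)
  have F: "ennreal (cdf ?M t) = (\<integral>\<^sup>+ x. w x * indicator {x. u \<bullet> x \<le> t} x \<partial>lborel)" for t
  proof -
    have "negligible (L - U)"
      using negligible_convex_frontier[OF \<open>convex L\<close>] closure_subset[of L]
      by (auto simp: frontier_def U_def intro: negligible_subset)
    then have "AE x in lebesgue. x \<notin> L - U"
      by (intro AE_not_in) (simp only: negligible_iff_null_sets)
    then have "(\<integral>\<^sup>+ x. ennreal (indicator (L \<inter> {x. u \<bullet> x \<in> {..t}}) x * \<phi> x) \<partial>lebesgue)
        = (\<integral>\<^sup>+ x. w x * indicator {x. u \<bullet> x \<le> t} x \<partial>lebesgue)"
      using U by (intro nn_integral_cong_AE) (auto elim!: eventually_mono simp: w_def indicator_def)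
    then show ?thesis
      by (simp add: cdf_def emeasure_eq_measure[symmetric] emeasure_marginal nn_integral_completion)
  qed
  have "cdf ?M s * cdf ?M t \<le> (cdf ?M ((s + t) / 2))\<^sup>2" for s t
  proof -
    have "ennreal (cdf ?M s) * ennreal (cdf ?M t) \<le> (ennreal (cdf ?M ((s + t) / 2)))\<^sup>2"
      unfolding F
    proof (rule Prekopa_Leindler)
      fix x y
      show "w x * indicator {x. u \<bullet> x \<le> s} x * (w y * indicator {x. u \<bullet> x \<le> t} y)
        \<le> (w ((1 / 2) *\<^sub>R (x + y)) * indicator {x. u \<bullet> x \<le> (s + t) / 2} ((1 / 2) *\<^sub>R (x + y)))\<^sup>2"
        using w_mid[of x y] by (auto simp: indicator_def inner_add_right)
    qed measurable
    then show ?thesis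
      using cdf_nonneg by (simp add: ennreal_mult[symmetric] ennreal_power)
  qed
  moreover
  obtain B where B: "\<And>x. x \<in> L \<Longrightarrow> norm x \<le> B" using \<open>bounded L\<close> by (auto simp: bounded_iff)
  \<comment> \<open>By Cauchy-Schwarz the functional is bounded on \<open>L\<close>, which gives
    \<open>cdf_mean_gt\<close> a bounded support.\<close>
  have "AE t in ?M. - (norm u * B) \<le> t \<and> t \<le> norm u * B"
  proof -
    have "- (norm u * B) \<le> u \<bullet> x \<and> u \<bullet> x \<le> norm u * B" if "x \<in> L" for x
      using Cauchy_Schwarz_ineq2[of u x] mult_left_mono[OF B[OF that], of "norm u"] by auto
    then have "AE x in density lebesgue (\<lambda>x. ennreal (indicator L x * \<phi> x)). - (norm u * B) \<le> u \<bullet> x \<and> u \<bullet> x \<le> norm u * B"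
      by (subst AE_density, measurable) (auto simp: indicator_def)
    then show ?thesis
      unfolding marginal_def by (subst AE_distr_iff) auto
  qed
  moreover have "measure ?M (space ?M) = I"
    using measure_marginal[of UNIV u] by (simp add: borel_UNIV I_def)
  ultimately show ?thesis
    using cdf_mean_gt[of "- (norm u * B)" "norm u * B"] marginal_atomless[OF \<open>u \<noteq> 0\<close>] \<open>0 < I\<close>
    by (simp add: integral_marginal cdf_def measure_marginal)
qed

section \<open>Floating bodies\<close>

context weighted_set
begin

lemma integrable_weight_scaleR:
  fixes g :: "'a \<Rightarrow> 'b::{banach, second_countable_topology}"
  assumes [measurable]: "g \<in> borel_measurable lebesgue" and bd: "\<And>y. y \<in> L \<Longrightarrow> norm (g y) \<le> C"
  shows "set_integrable lebesgue L (\<lambda>y. \<phi> y *\<^sub>R g y)"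
proof -
  have "integrable lebesgue (\<lambda>y. (indicator L y * \<phi> y) *\<^sub>R g y)"
  proof (rule Bochner_Integration.integrable_bound)
    show "integrable lebesgue (\<lambda>y. C * (indicator L y * \<phi> y))"
      using integrable by (simp add: set_integrable_def)
    show "AE y in lebesgue. norm ((indicator L y * \<phi> y) *\<^sub>R g y) \<le> norm (C * (indicator L y * \<phi> y))"
    proof (rule AE_I2)
      fix y
      have "norm (g y) * \<phi> y \<le> \<bar>C\<bar> * \<phi> y" if "y \<in> L"
        using bd[OF that] nonneg[OF that] by (intro mult_right_mono) auto
      then show "norm ((indicator L y * \<phi> y) *\<^sub>R g y) \<le> norm (C * (indicator L y * \<phi> y))"
        using nonneg by (auto simp: indicator_def abs_mult mult.commute)
    qed
  qed measurable
  then show ?thesis by (simp add: set_integrable_def)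
qed

text \<open>The two closed half-spaces overlap only in a hyperplane, which carries no
  weight.\<close>

lemma integral_le_add_ge:
  assumes "u \<noteq> 0"
  shows "set_lebesgue_integral lebesgue (L \<inter> {x. u \<bullet> x \<le> c}) \<phi> + set_lebesgue_integral lebesgue (L \<inter> {x. u \<bullet> x \<ge> c}) \<phi>
    = set_lebesgue_integral lebesgue L \<phi>"
proof -
  let ?M = "marginal L \<phi> u"
  interpret finite_borel_measure ?M by (rule finite_borel_marginal)
  have "{..c} \<union> {c..} = UNIV" "{..c} \<inter> {c..} = {c}" by auto
  then have "measure ?M UNIV = measure ?M {..c} + measure ?M {c..} - measure ?M {c}"
    using measure_Un3[of "{..c}" ?M "{c..}"] by (simp add: fmeasurable_eq_sets M_is_borel)
  then show ?thesis
    using marginal_atomless[OF assms] by (simp add: measure_marginal)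
qed

lemma integral_weight_mono:
  assumes "S \<subseteq> T" "S \<in> sets lebesgue" "T \<in> sets lebesgue" "T \<subseteq> L"
  shows "set_lebesgue_integral lebesgue S \<phi> \<le> set_lebesgue_integral lebesgue T \<phi>"
proof -
  have "set_integrable lebesgue S \<phi>" "set_integrable lebesgue T \<phi>"
    using assms by (auto intro: set_integrable_subset[OF integrable])
  then show ?thesis
    unfolding set_lebesgue_integral_def set_integrable_def
    using assms nonneg by (intro integral_mono) (auto simp: indicator_def)
qed

text \<open>If the cap through \<open>x\<close> weighed less than \<open>t\<close>, then by
  continuity so would a slightly larger cap with \<open>c < u \<bullet> x\<close>. Its complementary
  half-space takes part in the intersection but misses \<open>x\<close>.\<close>

lemma floating_body_tail:
  assumes "x \<in> weighted_floating_body t L \<phi>" "u \<noteq> 0"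
  shows "t \<le> set_lebesgue_integral lebesgue (L \<inter> {y. u \<bullet> y \<ge> u \<bullet> x}) \<phi>"
proof (rule ccontr)
  define N where "N c = set_lebesgue_integral lebesgue (L \<inter> {y. u \<bullet> y \<ge> c}) \<phi>" for c
  assume "\<not> t \<le> set_lebesgue_integral lebesgue (L \<inter> {y. u \<bullet> y \<ge> u \<bullet> x}) \<phi>"
  then have "N (u \<bullet> x) < t" by (simp add: N_def)
  moreover have "isCont N (u \<bullet> x)"
    unfolding N_def by (rule isCont_tail[OF \<open>u \<noteq> 0\<close>])
  ultimately have "eventually (\<lambda>c. N c < t) (at_left (u \<bullet> x))"
    by (intro order_tendstoD(2)[of N "N (u \<bullet> x)"]) (auto simp: isCont_def intro: filterlim_mono[OF _ order_refl at_le])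
  moreover have "eventually (\<lambda>c. c < u \<bullet> x) (at_left (u \<bullet> x))"
    by (simp add: eventually_at_filter)
  ultimately have "eventually (\<lambda>c. N c < t \<and> c < u \<bullet> x) (at_left (u \<bullet> x))"
    by (rule eventually_conj)
  then obtain c where c: "N c < t" "c < u \<bullet> x"
    using eventually_happens'[OF trivial_limit_at_left_real] by blast
  have "set_lebesgue_integral lebesgue ({x. u \<bullet> x \<ge> c} \<inter> L) \<phi> \<le> t"
    using c(1) by (simp add: N_def Int_commute)
  with \<open>u \<noteq> 0\<close> have "{y. u \<bullet> y \<le> c} \<in> {{x. u \<bullet> x \<le> c} |u c. u \<noteq> 0 \<and>
      set_lebesgue_integral lebesgue ({x. u \<bullet> x \<ge> c} \<inter> L) \<phi> \<le> t}"
    by blast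
  then have "u \<bullet> x \<le> c"
    using assms(1) unfolding weighted_floating_body_def by blast
  with c show False by simp
qed

text \<open>Through a point of the body, both half-spaces of any hyperplane weigh at least
  \<open>t\<close>, hence the total is at least \<open>2 * t\<close>.\<close>

lemma floating_body_empty:
  assumes "set_lebesgue_integral lebesgue L \<phi> < 2 * t"
  shows "weighted_floating_body t L \<phi> = {}"
proof (rule ccontr)
  assume "weighted_floating_body t L \<phi> \<noteq> {}"
  then obtain x where x: "x \<in> weighted_floating_body t L \<phi>" by auto
  obtain u :: 'a where "u \<noteq> 0" using nonzero_Basis by blast
  have "t \<le> set_lebesgue_integral lebesgue (L \<inter> {y. u \<bullet> y \<ge> u \<bullet> x}) \<phi>"
    by (rule floating_body_tail[OF x \<open>u \<noteq> 0\<close>])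
  moreover have "t \<le> set_lebesgue_integral lebesgue (L \<inter> {y. u \<bullet> y \<le> u \<bullet> x}) \<phi>"
    using floating_body_tail[OF x, of "- u"] \<open>u \<noteq> 0\<close> by simp
  ultimately show False
    using integral_le_add_ge[OF \<open>u \<noteq> 0\<close>, of "u \<bullet> x"] assms by simp
qed

text \<open>Moves the density \<open>\<phi> / \<delta>\<close> into Lebesgue integrals: mass 1
  becomes weighted mass \<open>\<delta>\<close>, and the barycentre acquires the factor
  \<open>1 / \<delta>\<close>. Existence of the vector integral is automatic because
  \<open>L\<close> is bounded and \<open>\<phi>\<close> integrable.\<close>

lemma mem_ulam_floating_body_iff:
  assumes "0 < \<delta>" "bounded L"
  shows "x \<in> weighted_ulam_floating_body \<delta> L \<phi> \<longleftrightarrow>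
    (\<exists>f\<in>borel_measurable lebesgue. (\<forall>y. 0 \<le> f y \<and> f y \<le> 1) \<and>
      set_lebesgue_integral lebesgue L (\<lambda>y. \<phi> y * f y) = \<delta> \<and>
      x = (1 / \<delta>) *\<^sub>R set_lebesgue_integral lebesgue L (\<lambda>y. \<phi> y *\<^sub>R (f y *\<^sub>R y)))"
proof -
  let ?\<mu> = "density lebesgue (\<lambda>x. ennreal (\<phi> x / \<delta> * indicator L x))"
  obtain B where B: "\<And>x. x \<in> L \<Longrightarrow> norm x \<le> B" using \<open>bounded L\<close> by (auto simp: bounded_iff)
  have W_measurable [measurable]: "(\<lambda>x. \<phi> x / \<delta> * indicator L x) \<in> borel_measurable lebesgue"
    using borel_measurable_divide[OF weight_measurable borel_measurable_const[of \<delta>]] by (simp add: mult.commute)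
  have W: "0 \<le> \<phi> x / \<delta> * indicator L x" for x
    using nonneg \<open>0 < \<delta>\<close> by (simp add: indicator_def)
  have id_measurable [measurable]: "(\<lambda>y::'a. y) \<in> borel_measurable lebesgue"
    by (intro measurable_completion) simp
  have mass: "(\<integral>\<^sup>+ y. ennreal (f y) \<partial>?\<mu>) = ennreal (set_lebesgue_integral lebesgue L (\<lambda>y. \<phi> y * f y) / \<delta>)"
    and int: "integrable ?\<mu> (\<lambda>y. f y *\<^sub>R y)"
    and mean: "(\<integral>y. f y *\<^sub>R y \<partial>?\<mu>) = (1 / \<delta>) *\<^sub>R set_lebesgue_integral lebesgue L (\<lambda>y. \<phi> y *\<^sub>R (f y *\<^sub>R y))"
    and nn: "0 \<le> set_lebesgue_integral lebesgue L (\<lambda>y. \<phi> y * f y)"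
    if f [measurable]: "f \<in> borel_measurable lebesgue" and f01: "\<forall>y. 0 \<le> f y \<and> f y \<le> 1" for f
  proof -
    have "integrable lebesgue (\<lambda>y. indicator L y * (\<phi> y * f y))"
      using integrable_weight_scaleR[OF f, of 1] f01 by (simp add: set_integrable_def)
    moreover have "(\<integral>\<^sup>+ y. ennreal (f y) \<partial>?\<mu>) = (\<integral>\<^sup>+ y. ennreal (indicator L y * (\<phi> y * f y) / \<delta>) \<partial>lebesgue)"
      using f01 W by (subst nn_integral_density, measurable)
        (auto simp: ennreal_mult'[symmetric] indicator_def intro!: nn_integral_cong)
    ultimately show "(\<integral>\<^sup>+ y. ennreal (f y) \<partial>?\<mu>) = ennreal (set_lebesgue_integral lebesgue L (\<lambda>y. \<phi> y * f y) / \<delta>)"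
      using f01 nonneg \<open>0 < \<delta>\<close>
      by (subst (asm) nn_integral_eq_integral) (auto simp: set_lebesgue_integral_def indicator_def)
    have "norm (f y *\<^sub>R y) \<le> B" if "y \<in> L" for y
      using B[OF that] f01 mult_right_mono[of "f y" 1 "norm y"] by auto
    then have "integrable lebesgue (\<lambda>y. (1 / \<delta>) *\<^sub>R (indicator L y *\<^sub>R (\<phi> y *\<^sub>R (f y *\<^sub>R y))))"
      using integrable_weight_scaleR[of "\<lambda>y. f y *\<^sub>R y" B]
      by (intro Bochner_Integration.integrable_scaleR_right) (simp add: set_integrable_def)
    moreover have eq: "\<And>y. (\<phi> y / \<delta> * indicator L y) *\<^sub>R (f y *\<^sub>R y) = (1 / \<delta>) *\<^sub>R (indicator L y *\<^sub>R (\<phi> y *\<^sub>R (f y *\<^sub>R y)))"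
      by (simp add: indicator_def)
    ultimately have "integrable lebesgue (\<lambda>y. (\<phi> y / \<delta> * indicator L y) *\<^sub>R (f y *\<^sub>R y))"
      by (simp only: eq)
    then show "integrable ?\<mu> (\<lambda>y. f y *\<^sub>R y)"
      using W by (subst integrable_density[OF borel_measurable_scaleR[OF f id_measurable] W_measurable]) auto
    show "(\<integral>y. f y *\<^sub>R y \<partial>?\<mu>) = (1 / \<delta>) *\<^sub>R set_lebesgue_integral lebesgue L (\<lambda>y. \<phi> y *\<^sub>R (f y *\<^sub>R y))"
      unfolding integral_density[OF borel_measurable_scaleR[OF f id_measurable] W_measurable AE_I2[OF W]] eq
      by (simp add: set_lebesgue_integral_def del: scaleR_scaleR)
    show "0 \<le> set_lebesgue_integral lebesgue L (\<lambda>y. \<phi> y * f y)"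
      unfolding set_lebesgue_integral_def using f01 nonneg
      by (intro Bochner_Integration.integral_nonneg) (auto simp: indicator_def)
  qed
  have mass_iff: "(\<integral>\<^sup>+ y. ennreal (f y) \<partial>?\<mu>) = 1 \<longleftrightarrow> set_lebesgue_integral lebesgue L (\<lambda>y. \<phi> y * f y) = \<delta>"
    if "f \<in> borel_measurable lebesgue" "\<forall>y. 0 \<le> f y \<and> f y \<le> 1" for f
    using mass[OF that] nn[OF that] \<open>0 < \<delta>\<close> by (auto simp: ennreal_eq_1)
  have "x \<in> weighted_ulam_floating_body \<delta> L \<phi> \<longleftrightarrow>
    (\<exists>f\<in>borel_measurable lebesgue. (\<forall>y. 0 \<le> f y \<and> f y \<le> 1) \<and> (\<integral>\<^sup>+ y. ennreal (f y) \<partial>?\<mu>) = 1 \<and>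
      integrable ?\<mu> (\<lambda>y. f y *\<^sub>R y) \<and> x = (\<integral>y. f y *\<^sub>R y \<partial>?\<mu>))"
    unfolding weighted_ulam_floating_body_def metronoid_def by auto
  then show ?thesis
    using mass_iff int mean by (simp cong: bex_cong conj_cong)
qed

text \<open>The conditions on \<open>f\<close> are preserved by convex combinations and the
  barycentre is linear in \<open>f\<close>, so the same combination of the two witnesses
  works.\<close>

lemma convex_ulam_floating_body:
  assumes "0 < \<delta>" "bounded L"
  shows "convex (weighted_ulam_floating_body \<delta> L \<phi>)"
proof (rule convexI)
  fix x y :: 'a and a b :: real
  assume x: "x \<in> weighted_ulam_floating_body \<delta> L \<phi>" and y: "y \<in> weighted_ulam_floating_body \<delta> L \<phi>"
    and ab: "0 \<le> a" "0 \<le> b" "a + b = 1"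
  obtain B where B: "\<And>x. x \<in> L \<Longrightarrow> norm x \<le> B" using \<open>bounded L\<close> by (auto simp: bounded_iff)
  obtain f where f [measurable]: "f \<in> borel_measurable lebesgue" and f01: "\<And>y. 0 \<le> f y" "\<And>y. f y \<le> 1"
    and fm: "set_lebesgue_integral lebesgue L (\<lambda>y. \<phi> y * f y) = \<delta>"
    and fx: "x = (1 / \<delta>) *\<^sub>R set_lebesgue_integral lebesgue L (\<lambda>y. \<phi> y *\<^sub>R (f y *\<^sub>R y))"
    using x unfolding mem_ulam_floating_body_iff[OF assms] by blast
  obtain g where g [measurable]: "g \<in> borel_measurable lebesgue" and g01: "\<And>y. 0 \<le> g y" "\<And>y. g y \<le> 1"
    and gm: "set_lebesgue_integral lebesgue L (\<lambda>y. \<phi> y * g y) = \<delta>"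
    and gy: "y = (1 / \<delta>) *\<^sub>R set_lebesgue_integral lebesgue L (\<lambda>y. \<phi> y *\<^sub>R (g y *\<^sub>R y))"
    using y unfolding mem_ulam_floating_body_iff[OF assms] by blast
  have id_measurable [measurable]: "(\<lambda>y::'a. y) \<in> borel_measurable lebesgue"
    by (intro measurable_completion) simp
  have bd: "norm (h y *\<^sub>R y) \<le> B" if "y \<in> L" "0 \<le> h y" "h y \<le> 1" for h y
    using B[OF that(1)] that mult_right_mono[of "h y" 1 "norm y"] by auto
  have int1: "set_integrable lebesgue L (\<lambda>y. \<phi> y * f y)" "set_integrable lebesgue L (\<lambda>y. \<phi> y * g y)"
    using integrable_weight_scaleR[of f 1] integrable_weight_scaleR[of g 1] f01 g01 by auto
  have int2: "set_integrable lebesgue L (\<lambda>y. \<phi> y *\<^sub>R (f y *\<^sub>R y))" "set_integrable lebesgue L (\<lambda>y. \<phi> y *\<^sub>R (g y *\<^sub>R y))"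
    using bd[OF _ f01] bd[OF _ g01] by (auto intro!: integrable_weight_scaleR[where C = B] simp del: scaleR_scaleR)
  define h where "h y = a * f y + b * g y" for y
  have "h \<in> borel_measurable lebesgue" unfolding h_def by measurable
  moreover have "\<forall>y. 0 \<le> h y \<and> h y \<le> 1"
  proof
    fix y
    have "a * f y + b * g y \<le> a * 1 + b * 1"
      using ab f01 g01 by (intro add_mono mult_left_mono) auto
    then show "0 \<le> h y \<and> h y \<le> 1" using ab f01 g01 by (auto simp: h_def)
  qed
  moreover have "set_lebesgue_integral lebesgue L (\<lambda>y. \<phi> y * h y) = \<delta>"
  proof -
    have "set_lebesgue_integral lebesgue L (\<lambda>y. \<phi> y * h y)
        = set_lebesgue_integral lebesgue L (\<lambda>y. a * (\<phi> y * f y) + b * (\<phi> y * g y))"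
      by (simp add: h_def algebra_simps)
    also have "\<dots> = a * \<delta> + b * \<delta>"
      using int1 by (subst set_integral_add) (auto simp: fm gm)
    also have "\<dots> = \<delta>" using ab by (simp flip: distrib_right)
    finally show ?thesis .
  qed
  moreover have "a *\<^sub>R x + b *\<^sub>R y = (1 / \<delta>) *\<^sub>R set_lebesgue_integral lebesgue L (\<lambda>y. \<phi> y *\<^sub>R (h y *\<^sub>R y))"
  proof -
    have "set_lebesgue_integral lebesgue L (\<lambda>y. \<phi> y *\<^sub>R (h y *\<^sub>R y))
        = set_lebesgue_integral lebesgue L (\<lambda>y. a *\<^sub>R (\<phi> y *\<^sub>R (f y *\<^sub>R y)) + b *\<^sub>R (\<phi> y *\<^sub>R (g y *\<^sub>R y)))"
      by (simp add: h_def algebra_simps)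
    also have "\<dots> = a *\<^sub>R set_lebesgue_integral lebesgue L (\<lambda>y. \<phi> y *\<^sub>R (f y *\<^sub>R y))
        + b *\<^sub>R set_lebesgue_integral lebesgue L (\<lambda>y. \<phi> y *\<^sub>R (g y *\<^sub>R y))"
      using int2 by (subst set_integral_add) (auto simp del: scaleR_scaleR)
    finally show ?thesis by (simp add: fx gy scaleR_add_right scaleR_left_commute)
  qed
  ultimately show "a *\<^sub>R x + b *\<^sub>R y \<in> weighted_ulam_floating_body \<delta> L \<phi>"
    unfolding mem_ulam_floating_body_iff[OF assms] by blast
qed

end

section \<open>Caps, the support function of the Ulam floating body and the two inclusions\<close>

locale log_concave_weight =
  fixes K :: "'a::euclidean_space set" and \<phi> :: "'a \<Rightarrow> real"
  assumes convex: "convex K" and bounded: "bounded K" and pos: "\<And>x. x \<in> K \<Longrightarrow> 0 < \<phi> x"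
    and int: "set_integrable lebesgue K \<phi>" and conc: "concave_on K (\<lambda>x. ln (\<phi> x))"
begin

sublocale weighted_set K \<phi>
  using measurable_convex[OF convex bounded] pos int
  by unfold_locales (auto simp: fmeasurable_def intro: less_imp_le)

lemma closed_Int_lebesgue [intro]: "closed S \<Longrightarrow> K \<inter> S \<in> sets lebesgue"
  using L by (intro sets.Int) auto

text \<open>Intermediate value theorem for the continuous tail, which falls from the total weight to
  zero.\<close>

lemma cap_exists:
  assumes "u \<noteq> 0" "0 < \<delta>" "\<delta> \<le> set_lebesgue_integral lebesgue K \<phi>"
  obtains s where "set_lebesgue_integral lebesgue (K \<inter> {x. u \<bullet> x \<ge> s}) \<phi> = \<delta>"
proof -
  obtain B where B: "0 < B" "\<And>x. x \<in> K \<Longrightarrow> norm x \<le> B" using bounded by (auto simp: bounded_pos)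
  define R where "R = norm u * B"
  have "0 \<le> R" using B by (simp add: R_def)
  have R: "- R \<le> u \<bullet> x" "u \<bullet> x \<le> R" if "x \<in> K" for x
    using Cauchy_Schwarz_ineq2[of u x] mult_left_mono[OF B(2)[OF that], of "norm u"] by (auto simp: R_def)
  \<comment> \<open>The upper end is \<open>R + 1\<close>, since the half-space at \<open>R\<close>
    may still touch \<open>K\<close>.\<close>
  have "K \<inter> {x. u \<bullet> x \<ge> - R} = K" "K \<inter> {x. u \<bullet> x \<ge> R + 1} = {}"
    using R by fastforce+
  then have "\<exists>s. - R \<le> s \<and> s \<le> R + 1 \<and> set_lebesgue_integral lebesgue (K \<inter> {x. u \<bullet> x \<ge> s}) \<phi> = \<delta>"
    using assms \<open>0 \<le> R\<close> isCont_tail[OF \<open>u \<noteq> 0\<close>]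
    by (intro IVT2) (auto simp: set_lebesgue_integral_def)
  then show ?thesis using that by blast
qed

text \<open>
  Among all \<open>f\<close> of mass \<open>\<delta>\<close>, the indicator of the cap of mass \<open>\<delta>\<close> maximises the first moment in
  direction \<open>u\<close>, so \<open>\<beta>\<close> is the support function of the Ulam floating body at \<open>u\<close>.
\<close>

lemma ulam_support:
  assumes "u \<noteq> 0" "0 < \<delta>" "\<delta> \<le> set_lebesgue_integral lebesgue K \<phi>"
  obtains \<beta> z where "z \<in> weighted_ulam_floating_body \<delta> K \<phi>" "u \<bullet> z = \<beta>"
    "\<And>x. x \<in> weighted_ulam_floating_body \<delta> K \<phi> \<Longrightarrow> u \<bullet> x \<le> \<beta>"
    "exp (- 1) * \<delta> < set_lebesgue_integral lebesgue (K \<inter> {x. u \<bullet> x \<ge> \<beta>}) \<phi>"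
    "set_lebesgue_integral lebesgue (K \<inter> {x. u \<bullet> x \<ge> \<beta>}) \<phi> < (1 - exp (- 1)) * \<delta>"
proof -
  obtain B where B: "\<And>x. x \<in> K \<Longrightarrow> norm x \<le> B" using bounded by (auto simp: bounded_iff)
  obtain s where s: "set_lebesgue_integral lebesgue (K \<inter> {x. u \<bullet> x \<ge> s}) \<phi> = \<delta>"
    using cap_exists[OF assms] .
  define C where "C = K \<inter> {x. u \<bullet> x \<ge> s}"
  have "C \<subseteq> K" by (auto simp: C_def)
  have "C \<in> sets lebesgue"
    unfolding C_def by (intro closed_Int_lebesgue closed_halfspace_ge)
  \<comment> \<open>A cap inherits convexity and log-concavity, so Gruenbaum's inequality applies to
    \<open>C\<close> itself, whose barycentre has \<open>u\<close>-coordinate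
    \<open>\<beta>\<close>.\<close>
  interpret C: log_concave_weight C \<phi>
  proof
    show "convex C" unfolding C_def by (intro convex_Int convex convex_halfspace_ge)
    show "bounded C" using bounded \<open>C \<subseteq> K\<close> by (rule bounded_subset)
    show "set_integrable lebesgue C \<phi>"
      using int \<open>C \<in> sets lebesgue\<close> \<open>C \<subseteq> K\<close> by (rule set_integrable_subset)
    show "concave_on C (\<lambda>x. ln (\<phi> x))"
      using conc \<open>C \<subseteq> K\<close> \<open>convex C\<close> by (auto simp: concave_on_def intro: convex_on_subset)
  qed (use pos \<open>C \<subseteq> K\<close> in auto)
  have mass: "set_lebesgue_integral lebesgue C \<phi> = \<delta>" using s by (simp add: C_def)
  define \<beta> where "\<beta> = set_lebesgue_integral lebesgue C (\<lambda>x. \<phi> x * (u \<bullet> x)) / \<delta>"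
  have low: "exp (- 1) * \<delta> < set_lebesgue_integral lebesgue (C \<inter> {x. u \<bullet> x \<le> \<beta>}) \<phi>"
    using Gruenbaum_log_concave[OF C.convex C.bounded C.pos C.int C.conc \<open>u \<noteq> 0\<close>] \<open>0 < \<delta>\<close>
    by (simp add: mass \<beta>_def)
  have "set_lebesgue_integral lebesgue C (\<lambda>x. \<phi> x * (- u \<bullet> x)) = - set_lebesgue_integral lebesgue C (\<lambda>x. \<phi> x * (u \<bullet> x))"
    by (simp add: set_lebesgue_integral_def)
  then have high: "exp (- 1) * \<delta> < set_lebesgue_integral lebesgue (C \<inter> {x. u \<bullet> x \<ge> \<beta>}) \<phi>"
    using Gruenbaum_log_concave[OF C.convex C.bounded C.pos C.int C.conc, of "- u"] \<open>0 < \<delta>\<close> \<open>u \<noteq> 0\<close>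
    by (simp add: mass \<beta>_def)
  \<comment> \<open>Ensures that the part of \<open>K\<close> above \<open>\<beta>\<close> already
    lies in \<open>C\<close>, so that bounds for \<open>C\<close> carry over to
    \<open>K\<close>.\<close>
  have "s \<le> \<beta>"
  proof (rule ccontr)
    assume "\<not> s \<le> \<beta>"
    then have "C \<inter> {x. u \<bullet> x \<le> \<beta>} = {}" by (auto simp: C_def)
    with low have "exp (- 1) * \<delta> < 0" by (simp add: set_lebesgue_integral_def)
    with \<open>0 < \<delta>\<close> show False by (simp add: mult_less_0_iff)
  qed
  then have C_beta: "C \<inter> {x. u \<bullet> x \<ge> \<beta>} = K \<inter> {x. u \<bullet> x \<ge> \<beta>}" by (auto simp: C_def)
  have inner_mean: "set_integrable lebesgue K (\<lambda>y. \<phi> y *\<^sub>R (f y *\<^sub>R y))"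
      "set_integrable lebesgue K (\<lambda>y. \<phi> y *\<^sub>R f y)"
      "set_integrable lebesgue K (\<lambda>y. \<phi> y *\<^sub>R (f y * (u \<bullet> y)))"
      "u \<bullet> ((1 / \<delta>) *\<^sub>R set_lebesgue_integral lebesgue K (\<lambda>y. \<phi> y *\<^sub>R (f y *\<^sub>R y)))
        = set_lebesgue_integral lebesgue K (\<lambda>y. \<phi> y * (f y * (u \<bullet> y))) / \<delta>"
    if f [measurable]: "f \<in> borel_measurable lebesgue" and f01: "\<forall>y. 0 \<le> f y \<and> f y \<le> 1" for f
  proof -
    have id_measurable [measurable]: "(\<lambda>y::'a. y) \<in> borel_measurable lebesgue"
      by (intro measurable_completion) simp
    have bd: "norm (f y *\<^sub>R y) \<le> B" if "y \<in> K" for y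
      using B[OF that] f01 mult_right_mono[of "f y" 1 "norm y"] by auto
    then show 1: "set_integrable lebesgue K (\<lambda>y. \<phi> y *\<^sub>R (f y *\<^sub>R y))"
      by (intro integrable_weight_scaleR[where C = B]) auto
    show "set_integrable lebesgue K (\<lambda>y. \<phi> y *\<^sub>R f y)"
      using f01 by (intro integrable_weight_scaleR[where C = 1]) auto
    have "norm (f y * (u \<bullet> y)) \<le> norm u * B" if "y \<in> K" for y
      using order_trans[OF Cauchy_Schwarz_ineq2[of u "f y *\<^sub>R y"] mult_left_mono[OF bd[OF that]]] by simp
    then show "set_integrable lebesgue K (\<lambda>y. \<phi> y *\<^sub>R (f y * (u \<bullet> y)))"
      by (intro integrable_weight_scaleR[where C = "norm u * B"]) auto
    have "u \<bullet> set_lebesgue_integral lebesgue K (\<lambda>y. \<phi> y *\<^sub>R (f y *\<^sub>R y))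
        = (\<integral>y. u \<bullet> (indicator K y *\<^sub>R (\<phi> y *\<^sub>R (f y *\<^sub>R y))) \<partial>lebesgue)"
      unfolding set_lebesgue_integral_def
      by (rule integral_inner_right[symmetric]) (use 1 in \<open>simp only: set_integrable_def\<close>)
    then show "u \<bullet> ((1 / \<delta>) *\<^sub>R set_lebesgue_integral lebesgue K (\<lambda>y. \<phi> y *\<^sub>R (f y *\<^sub>R y)))
        = set_lebesgue_integral lebesgue K (\<lambda>y. \<phi> y * (f y * (u \<bullet> y))) / \<delta>"
      by (simp add: set_lebesgue_integral_def mult.assoc)
  qed
  define g :: "'a \<Rightarrow> real" where "g = indicator {x. u \<bullet> x \<ge> s}"
  have g [measurable]: "g \<in> borel_measurable lebesgue"
    unfolding g_def by (intro borel_measurable_indicator) (auto simp: closed_halfspace_ge)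
  have g01: "\<forall>y. 0 \<le> g y \<and> g y \<le> 1" by (auto simp: g_def indicator_def)
  have gK: "set_lebesgue_integral lebesgue K (\<lambda>y. \<phi> y * (g y * h y)) = set_lebesgue_integral lebesgue C (\<lambda>y. \<phi> y * h y)" for h
    unfolding set_lebesgue_integral_def g_def C_def
    by (intro Bochner_Integration.integral_cong) (auto simp: indicator_def)
  have g_mass: "set_lebesgue_integral lebesgue K (\<lambda>y. \<phi> y * g y) = \<delta>"
    using gK[of "\<lambda>_. 1"] by (simp add: mass)
  define z where "z = (1 / \<delta>) *\<^sub>R set_lebesgue_integral lebesgue K (\<lambda>y. \<phi> y *\<^sub>R (g y *\<^sub>R y))"
  have "z \<in> weighted_ulam_floating_body \<delta> K \<phi>"
    unfolding mem_ulam_floating_body_iff[OF \<open>0 < \<delta>\<close> bounded] using g g01 g_mass z_def by blast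
  moreover have "u \<bullet> z = \<beta>"
    unfolding z_def inner_mean(4)[OF g g01] gK \<beta>_def ..
  moreover have "u \<bullet> x \<le> \<beta>" if x_mem: "x \<in> weighted_ulam_floating_body \<delta> K \<phi>" for x
  proof -
    obtain f where f [measurable]: "f \<in> borel_measurable lebesgue" and f01: "\<forall>y. 0 \<le> f y \<and> f y \<le> 1"
      and f_mass: "set_lebesgue_integral lebesgue K (\<lambda>y. \<phi> y * f y) = \<delta>"
      and x: "x = (1 / \<delta>) *\<^sub>R set_lebesgue_integral lebesgue K (\<lambda>y. \<phi> y *\<^sub>R (f y *\<^sub>R y))"
      using x_mem unfolding mem_ulam_floating_body_iff[OF \<open>0 < \<delta>\<close> bounded] by blast
    \<comment> \<open>Both \<open>f\<close> and \<open>g\<close> have mass \<open>\<delta>\<close>,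
      so subtracting \<open>s\<close> times the mass shifts their first moments equally.\<close>
    have shift: "set_integrable lebesgue K (\<lambda>y. \<phi> y * (h y * (u \<bullet> y)) - s * (\<phi> y * h y))"
      "set_lebesgue_integral lebesgue K (\<lambda>y. \<phi> y * (h y * (u \<bullet> y)) - s * (\<phi> y * h y))
        = set_lebesgue_integral lebesgue K (\<lambda>y. \<phi> y * (h y * (u \<bullet> y))) - s * set_lebesgue_integral lebesgue K (\<lambda>y. \<phi> y * h y)"
      if "h \<in> borel_measurable lebesgue" "\<forall>y. 0 \<le> h y \<and> h y \<le> 1" for h
      using inner_mean(2,3)[OF that] by (auto intro!: set_integral_diff)
    have "set_lebesgue_integral lebesgue K (\<lambda>y. \<phi> y * (f y * (u \<bullet> y)) - s * (\<phi> y * f y))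
        \<le> set_lebesgue_integral lebesgue K (\<lambda>y. \<phi> y * (g y * (u \<bullet> y)) - s * (\<phi> y * g y))"
    proof (rule set_integral_mono[OF shift(1)[OF f f01] shift(1)[OF g g01]])
      fix y assume "y \<in> K"
      \<comment> \<open>Pointwise optimality of the cap: \<open>g\<close> is 1 where
        \<open>u \<bullet> y - s\<close> is nonnegative and 0 where it is negative.\<close>
      have "f y * (u \<bullet> y - s) \<le> g y * (u \<bullet> y - s)"
        using f01 by (cases "s \<le> u \<bullet> y") (auto simp: g_def mult_left_le_one_le mult_nonneg_nonpos)
      then have "\<phi> y * (f y * (u \<bullet> y - s)) \<le> \<phi> y * (g y * (u \<bullet> y - s))"
        using pos[OF \<open>y \<in> K\<close>] by simp
      then show "\<phi> y * (f y * (u \<bullet> y)) - s * (\<phi> y * f y) \<le> \<phi> y * (g y * (u \<bullet> y)) - s * (\<phi> y * g y)"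
        by (simp add: algebra_simps)
    qed
    then have "set_lebesgue_integral lebesgue K (\<lambda>y. \<phi> y * (f y * (u \<bullet> y))) \<le> set_lebesgue_integral lebesgue K (\<lambda>y. \<phi> y * (g y * (u \<bullet> y)))"
      unfolding shift(2)[OF f f01] shift(2)[OF g g01] f_mass g_mass by simp
    then have "u \<bullet> x \<le> u \<bullet> z"
      unfolding x z_def inner_mean(4)[OF f f01] inner_mean(4)[OF g g01]
      using \<open>0 < \<delta>\<close> by (simp add: divide_right_mono)
    with \<open>u \<bullet> z = \<beta>\<close> show ?thesis by simp
  qed
  \<comment> \<open>The upper part of \<open>C\<close> is what remains of the mass
    \<open>\<delta>\<close> after the lower part, which exceeds \<open>\<delta> / e\<close>.\<close>
  moreover have "set_lebesgue_integral lebesgue (K \<inter> {x. u \<bullet> x \<ge> \<beta>}) \<phi> < (1 - exp (- 1)) * \<delta>"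
    using C.integral_le_add_ge[OF \<open>u \<noteq> 0\<close>, of \<beta>] low by (simp add: C_beta mass left_diff_distrib)
  moreover have "exp (- 1) * \<delta> < set_lebesgue_integral lebesgue (K \<inter> {x. u \<bullet> x \<ge> \<beta>}) \<phi>"
    using high by (simp add: C_beta)
  ultimately show ?thesis using that by blast
qed

text \<open>Separate a point \<open>x\<close> outside the Ulam floating body from it by
  \<open>u\<close>. The maximum \<open>\<beta>\<close> of \<open>u\<close> over that body is
  attained, so \<open>\<beta> \<le> u \<bullet> x\<close>, and the cap through \<open>x\<close>
  weighs strictly less than \<open>floating_body_tail\<close> demands.\<close>

lemma floating_body_subset_ulam:
  assumes "0 < \<delta>"
  shows "weighted_floating_body ((1 - exp (- 1)) * \<delta>) K \<phi> \<subseteq> weighted_ulam_floating_body \<delta> K \<phi>"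
proof (cases "\<delta> \<le> set_lebesgue_integral lebesgue K \<phi>")
  case True
  let ?M = "weighted_ulam_floating_body \<delta> K \<phi>"
  show ?thesis
  proof (rule subsetI, rule ccontr)
    fix x assume x: "x \<in> weighted_floating_body ((1 - exp (- 1)) * \<delta>) K \<phi>" and "x \<notin> ?M"
    \<comment> \<open>The direction \<open>v\<close> is arbitrary and serves only to show that
      \<open>?M\<close> is nonempty, as separation requires.\<close>
    obtain v :: 'a where "v \<noteq> 0" using nonzero_Basis by blast
    from ulam_support[OF this assms True] have "?M \<noteq> {}" by blast
    then obtain u \<alpha> where u: "u \<noteq> 0" "\<And>y. y \<in> ?M \<Longrightarrow> u \<bullet> y \<le> \<alpha>" "\<alpha> \<le> u \<bullet> x"
      using separating_hyperplane_sets[OF convex_ulam_floating_body[OF assms bounded], of "{x}"] \<open>x \<notin> ?M\<close> by auto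
    obtain \<beta> z where z: "z \<in> ?M" "u \<bullet> z = \<beta>"
      and \<beta>: "set_lebesgue_integral lebesgue (K \<inter> {x. u \<bullet> x \<ge> \<beta>}) \<phi> < (1 - exp (- 1)) * \<delta>"
      using ulam_support[OF u(1) assms True] by metis
    have "\<beta> \<le> u \<bullet> x" using u(2)[OF z(1)] u(3) z(2) by simp
    then have "set_lebesgue_integral lebesgue (K \<inter> {y. u \<bullet> y \<ge> u \<bullet> x}) \<phi> \<le> set_lebesgue_integral lebesgue (K \<inter> {y. u \<bullet> y \<ge> \<beta>}) \<phi>"
      by (intro integral_weight_mono closed_Int_lebesgue closed_halfspace_ge) auto
    with \<beta> floating_body_tail[OF x u(1)] show False by simp
  qed
next
  case False
  \<comment> \<open>From \<open>e \<ge> 2\<close>, twice the threshold is at least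
    \<open>\<delta>\<close>, which exceeds the total weight here, so the left-hand body is
    empty.\<close>
  have "2 * exp (- 1) \<le> (1::real)"
    using exp_ge_add_one_self[of 1] by (simp add: exp_minus field_simps)
  then have "\<delta> \<le> 2 * (1 - exp (- 1)) * \<delta>" using assms by simp
  then have "\<delta> \<le> 2 * ((1 - exp (- 1)) * \<delta>)" by (simp only: mult.assoc)
  then have "set_lebesgue_integral lebesgue K \<phi> < 2 * ((1 - exp (- 1)) * \<delta>)"
    using False by linarith
  then show ?thesis by (simp add: floating_body_empty)
qed

text \<open>If \<open>u \<bullet> x\<close> exceeded \<open>c\<close>, the support value
  \<open>\<beta> \<ge> u \<bullet> x\<close> would too; the cap at \<open>c\<close> would contain
  the one at \<open>\<beta>\<close> and so weigh more than \<open>\<delta> / e\<close>.\<close>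

lemma ulam_subset_floating_body:
  assumes "0 < \<delta>"
  shows "weighted_ulam_floating_body \<delta> K \<phi> \<subseteq> weighted_floating_body (exp (- 1) * \<delta>) K \<phi>"
proof
  fix x assume x: "x \<in> weighted_ulam_floating_body \<delta> K \<phi>"
  obtain f where f: "f \<in> borel_measurable lebesgue" and f01: "\<forall>y. 0 \<le> f y \<and> f y \<le> 1"
    and f_mass: "set_lebesgue_integral lebesgue K (\<lambda>y. \<phi> y * f y) = \<delta>"
    using x unfolding mem_ulam_floating_body_iff[OF assms bounded] by blast
  have "set_integrable lebesgue K (\<lambda>y. \<phi> y * f y)"
    using integrable_weight_scaleR[OF f, of 1] f01 by auto
  \<comment> \<open>A function \<open>f \<le> 1\<close> of weighted mass \<open>\<delta>\<close>
    exists only if the total weight is at least \<open>\<delta>\<close>; this makes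
    \<open>ulam_support\<close> available.\<close>
  then have le: "\<delta> \<le> set_lebesgue_integral lebesgue K \<phi>"
    unfolding f_mass[symmetric] using int f01 pos by (intro set_integral_mono) (auto simp: less_imp_le mult_left_le)
  have "u \<bullet> x \<le> c" if "u \<noteq> 0" and c: "set_lebesgue_integral lebesgue ({x. u \<bullet> x \<ge> c} \<inter> K) \<phi> \<le> exp (- 1) * \<delta>" for u c
  proof (rule ccontr)
    assume "\<not> u \<bullet> x \<le> c"
    obtain \<beta> where \<beta>: "u \<bullet> x \<le> \<beta>" "exp (- 1) * \<delta> < set_lebesgue_integral lebesgue (K \<inter> {x. u \<bullet> x \<ge> \<beta>}) \<phi>"
      using ulam_support[OF \<open>u \<noteq> 0\<close> assms le] x by metis
    have "set_lebesgue_integral lebesgue (K \<inter> {y. u \<bullet> y \<ge> \<beta>}) \<phi> \<le> set_lebesgue_integral lebesgue (K \<inter> {y. u \<bullet> y \<ge> c}) \<phi>"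
      using \<beta>(1) \<open>\<not> u \<bullet> x \<le> c\<close> by (intro integral_weight_mono closed_Int_lebesgue closed_halfspace_ge) auto
    with \<beta>(2) c show False by (simp add: Int_commute)
  qed
  then show "x \<in> weighted_floating_body (exp (- 1) * \<delta>) K \<phi>"
    unfolding weighted_floating_body_def by blast
qed

end

theorem theorem1p1:
  fixes K :: "(real ^ 'n) set" and \<delta> :: real
  assumes "convex_body K" and "0 < \<delta>" and "\<delta> < measure lebesgue K"
  shows "(\<forall>\<phi> :: real ^ 'n \<Rightarrow> real.
            (\<forall>x\<in>K. 0 < \<phi> x) \<and> set_integrable lebesgue K \<phi> \<and> concave_on K (\<lambda>x. ln (\<phi> x)) \<longrightarrow>
              weighted_floating_body ((exp 1 - 1) / exp 1 * \<delta>) K \<phi>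
                \<subseteq> weighted_ulam_floating_body \<delta> K \<phi> \<and>
              weighted_ulam_floating_body \<delta> K \<phi> \<subseteq> weighted_floating_body (\<delta> / exp 1) K \<phi>)
       \<and> floating_body ((exp 1 - 1) / exp 1 * \<delta>) K \<subseteq> ulam_floating_body \<delta> K
       \<and> ulam_floating_body \<delta> K \<subseteq> floating_body (\<delta> / exp 1) K"
proof -
  have K: "convex K" "bounded K" "K \<in> lmeasurable"
    using assms(1) by (auto simp: convex_body_def compact_imp_bounded lmeasurable_compact)
  have e: "(exp 1 - 1) / exp 1 * \<delta> = (1 - exp (- 1)) * \<delta>" "\<delta> / exp 1 = exp (- 1) * \<delta>"
    by (simp_all add: exp_minus field_simps)
  have main: "weighted_floating_body ((exp 1 - 1) / exp 1 * \<delta>) K \<phi> \<subseteq> weighted_ulam_floating_body \<delta> K \<phi> \<and>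
      weighted_ulam_floating_body \<delta> K \<phi> \<subseteq> weighted_floating_body (\<delta> / exp 1) K \<phi>"
    if "\<forall>x\<in>K. 0 < \<phi> x" "set_integrable lebesgue K \<phi>" "concave_on K (\<lambda>x. ln (\<phi> x))" for \<phi>
  proof -
    interpret log_concave_weight K \<phi>
      using K that by unfold_locales auto
    show ?thesis
      unfolding e using floating_body_subset_ulam ulam_subset_floating_body \<open>0 < \<delta>\<close> by simp
  qed
  moreover have "set_integrable lebesgue K (\<lambda>_. 1 :: real)"
    using K(3) by (auto simp: set_integrable_def fmeasurable_def intro!: integrable_real_indicator)
  moreover have "concave_on K (\<lambda>_. ln 1 :: real)"
    using K by (simp add: concave_on_def convex_on_const)
  ultimately show ?thesis
    using main[of "\<lambda>_. 1"] by (simp add: floating_body_def ulam_floating_body_def)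
qed

end
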